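(* Let $\theta=\pi/4$, i.e. $a=b=c/\sqrt2$ (so that $\ln(a/c)/\ln(b/2c)=1/3$), and consider any hierarchical tiling of the plane based on this isosceles right triangle. The tiling is nonperiodic. The tiles meet in only a finite number of ways.
   Context: A tile is a right isosceles triangle with an ordered triple of vertices $(A,C,B)$, with right angle at $C$. Although the two legs have the same length, they are distinguished: $AC$ is called the long leg and $CB$ the short leg. Subdivision rule: let $F$ be the foot of the perpendicular from $C$ to $AB$, and let $M,N,K$ be the midpoints of $AC$, $AF$, $FC$. The tile $(A,C,B)$ is divided into the five daughter tiles, with labeled vertices, $(A,N,M)$, $(M,K,C)$, $(M,K,F)$, $(F,N,M)$ (each smaller than the parent by the linear factor $b/(2c)=2^{-3/2}$) and $(C,F,B)$ (smaller by the linear factor $a/c=2^{-1/2}$). Let $T$ be the basic tile with hypotenuse $c$. Put $T_0=\{T\}$, and for $n\ge1$ let $T_n$ be obtained from $T_{n-1}$ by subdividing every tile of $T_{n-1}$ that has the largest hypotenuse occurring in $T_{n-1}$. A supertile of order $n$ is a collection of tiles of the form $e(s(T_n))$, where $s$ is a rescaling and $e$ is a Euclidean motion (possibly orientation reversing). A hierarchical tiling of the plane is a tiling of the plane that is the union of supertiles $S_1\subsetneq S_2\subsetneq\cdots$ of orders $N_1<N_2<\cdots$, where for each $i$, writing $S_{i+1}=e(s(T_{N_{i+1}}))$, there are $n\le N_{i+1}$ and a tile $t\in T_n$ such that $S_i$ is the image under $e\circ s$ of the set of tiles of $T_{N_{i+1}}$ contained in $t$. A tiling of the plane is periodic if it is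 invariant under two linearly independent translations. The number of ways in which tiles meet is the number of congruence classes of pairs of distinct tiles of the tiling whose boundaries share a segment of positive length. *)

theory Defs
  imports "HOL-Analysis.Analysis"
begin

text \<open>The Euclidean plane is \<^typ>\<open>complex\<close>. A tile is its labelled vertex triple
  \<open>(A, C, B)\<close>; its region is the convex hull. The labels are part of the tile, so all maps
  between tiles and all invariance and congruence notions below respect them.\<close>

type_synonym tile = "complex \<times> complex \<times> complex"

fun is_tile :: "tile \<Rightarrow> bool" where
  "is_tile (A, C, B) \<longleftrightarrow> A \<noteq> C \<and> (A - C) \<bullet> (B - C) = 0 \<and> dist A C = dist C B"

fun hypotenuse :: "tile \<Rightarrow> real" where
  "hypotenuse (A, C, B) = dist A B"

fun region :: "tile \<Rightarrow> complex set" where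
  "region (A, C, B) = convex hull {A, C, B}"

fun map_tile :: "(complex \<Rightarrow> complex) \<Rightarrow> tile \<Rightarrow> tile" where
  "map_tile f (A, C, B) = (f A, f C, f B)"

definition foot :: "complex \<Rightarrow> complex \<Rightarrow> complex \<Rightarrow> complex" where
  "foot C A B = A + (((C - A) \<bullet> (B - A)) / ((B - A) \<bullet> (B - A))) *\<^sub>R (B - A)"

lemma foot_is_perpendicular_foot:
  assumes "A \<noteq> B"
  shows "foot C A B \<in> affine hull {A, B}" and "(C - foot C A B) \<bullet> (B - A) = 0"
proof -
  let ?t = "((C - A) \<bullet> (B - A)) / ((B - A) \<bullet> (B - A))"
  have "foot C A B = (1 - ?t) *\<^sub>R A + ?t *\<^sub>R B"
    unfolding foot_def by (simp add: algebra_simps)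
  moreover have "(1 - ?t) + ?t = 1" by simp
  ultimately show "foot C A B \<in> affine hull {A, B}"
    unfolding affine_hull_2 by blast
  have "C - foot C A B = (C - A) - ?t *\<^sub>R (B - A)"
    by (simp add: foot_def algebra_simps)
  then have "(C - foot C A B) \<bullet> (B - A) = (C - A) \<bullet> (B - A) - ?t * ((B - A) \<bullet> (B - A))"
    by (simp only: inner_diff_left[of "C - A"] inner_scaleR_left)
  then show "(C - foot C A B) \<bullet> (B - A) = 0"
    using assms by simp
qed

lemma is_tile_legs:
  assumes "is_tile (A, C, B)"
  shows "dist A C = dist A B / sqrt 2" and "dist C B = dist A B / sqrt 2"
    and "ln (dist C B / dist A B) / ln (dist A C / (2 * dist A B)) = 1 / 3"
proof -
  have o: "(A - C) \<bullet> (B - C) = 0" and e: "dist A C = dist C B" and ne: "A \<noteq> C"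
    using assms by auto
  have "A - B = (A - C) - (B - C)" by simp
  then have "(norm (A - B))\<^sup>2 = (norm (A - C))\<^sup>2 + (norm (B - C))\<^sup>2"
    using o by (simp only: power2_norm_eq_inner inner_diff_left[of "A - C"]
        inner_diff_right[of _ "A - C"] inner_commute[of "B - C" "A - C"])
  then have "(dist A B)\<^sup>2 = 2 * (dist A C)\<^sup>2"
    using e by (simp add: dist_norm norm_minus_commute)
  then have *: "dist A B = sqrt 2 * dist A C"
    by (metis real_sqrt_mult real_sqrt_unique zero_le_dist)
  then show 1: "dist A C = dist A B / sqrt 2" by simp
  with e show 2: "dist C B = dist A B / sqrt 2" by simp
  have "dist A B > 0" using * ne by simp
  then have "dist C B / dist A B = 1 / sqrt 2"
    "dist A C / (2 * dist A B) = (1 / sqrt 2) ^ 3"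
    by (simp_all add: 1 2 power3_eq_cube)
  then have "ln (dist A C / (2 * dist A B)) = 3 * ln (dist C B / dist A B)"
    by (simp add: ln_realpow)
  moreover have "ln (dist C B / dist A B) \<noteq> 0"
    using \<open>dist C B / dist A B = 1 / sqrt 2\<close> by (simp add: ln_div)
  ultimately show "ln (dist C B / dist A B) / ln (dist A C / (2 * dist A B)) = 1 / 3"
    by simp
qed

fun daughters :: "tile \<Rightarrow> tile set" where
  "daughters (A, C, B) =
    (let F = foot C A B; M = midpoint A C; N = midpoint A F; K = midpoint F C
     in {(A, N, M), (M, K, C), (M, K, F), (F, N, M), (C, F, B)})"

definition subdivide_largest :: "tile set \<Rightarrow> tile set" where
  "subdivide_largest S =
    (\<Union>t\<in>S. if \<forall>u\<in>S. hypotenuse u \<le> hypotenuse t then daughters t else {t})"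

definition subdivision :: "tile \<Rightarrow> nat \<Rightarrow> tile set" where
  "subdivision T n = (subdivide_largest ^^ n) {T}"

text \<open>Isometries of the plane, orientation preserving or reversing; they are automatically
  bijective.\<close>

definition euclidean_motion :: "(complex \<Rightarrow> complex) \<Rightarrow> bool" where
  "euclidean_motion e \<longleftrightarrow> (\<forall>x y. dist (e x) (e y) = dist x y)"

definition rescaling :: "(complex \<Rightarrow> complex) \<Rightarrow> bool" where
  "rescaling s \<longleftrightarrow> (\<exists>r>0. s = (\<lambda>z. r *\<^sub>R z))"

definition supertile :: "tile \<Rightarrow> nat \<Rightarrow> tile set \<Rightarrow> bool" where
  "supertile T n S \<longleftrightarrow>
    (\<exists>e s. euclidean_motion e \<and> rescaling s \<and> S = map_tile (e \<circ> s) ` subdivision T n)"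

definition tiling_of_plane :: "tile set \<Rightarrow> bool" where
  "tiling_of_plane X \<longleftrightarrow>
    (\<forall>t\<in>X. is_tile t) \<and>
    (\<Union>t\<in>X. region t) = UNIV \<and>
    (\<forall>t\<in>X. \<forall>u\<in>X. t \<noteq> u \<longrightarrow> interior (region t) \<inter> interior (region u) = {})"

definition hierarchical_tiling :: "tile \<Rightarrow> tile set \<Rightarrow> bool" where
  "hierarchical_tiling T X \<longleftrightarrow>
    tiling_of_plane X \<and>
    (\<exists>(S :: nat \<Rightarrow> tile set) (N :: nat \<Rightarrow> nat).
      strict_mono N \<and>
      (\<forall>i. supertile T (N i) (S i)) \<and>
      (\<forall>i. S i \<subset> S (Suc i)) \<and>
      (\<forall>i. \<exists>e s. euclidean_motion e \<and> rescaling s \<and>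
        S (Suc i) = map_tile (e \<circ> s) ` subdivision T (N (Suc i)) \<and>
        (\<exists>n t. n \<le> N (Suc i) \<and> t \<in> subdivision T n \<and>
          S i = map_tile (e \<circ> s) `
            {u \<in> subdivision T (N (Suc i)). region u \<subseteq> region t})) \<and>
      X = (\<Union>i. S i))"

definition periodic_tiling :: "tile set \<Rightarrow> bool" where
  "periodic_tiling X \<longleftrightarrow>
    (\<exists>v w. v \<noteq> w \<and> independent {v, w} \<and>
      map_tile (\<lambda>z. z + v) ` X = X \<and> map_tile (\<lambda>z. z + w) ` X = X)"

text \<open>Unordered pairs of distinct tiles that meet along a nondegenerate segment.\<close>

definition meeting_pairs :: "tile set \<Rightarrow> tile set set" where
  "meeting_pairs X = {{t, u} | t u. t \<in> X \<and> u \<in> X \<and> t \<noteq> u \<and>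
    (\<exists>p q. p \<noteq> q \<and> closed_segment p q \<subseteq> frontier (region t) \<inter> frontier (region u))}"

definition congruence :: "(tile set \<times> tile set) set" where
  "congruence = {(P, Q). \<exists>e. euclidean_motion e \<and> Q = map_tile e ` P}"

definition ways_of_meeting :: "tile set \<Rightarrow> tile set set set" where
  "ways_of_meeting X = meeting_pairs X // congruence"

end

theory Submission
  imports Defs
begin

text \<open>
  Up to a similarity, the tiles of \<open>T\<^sub>n\<close> of level \<open>k\<close> (hypotenuse \<open>2\<^sup>-\<^sup>k\<^sup>/\<^sup>2\<close>, \<open>n \<le> k \<le> n + 2\<close>) have their acute
  vertices at neighbouring points of the lattice \<open>\<Lambda>\<^sub>k = (1 + \<i>)\<^sup>-\<^sup>k \<int>[\<i>]\<close>. Since the hypotenuses in a supertile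
  of positive order have ratio between 1 and 2 and both bounds are attained, nested supertiles use the same
  scale, and two tiles that touch are, up to congruence, one of finitely many pairs.

  If \<open>v\<close> is a period, pull it back to the coordinates of a large supertile \<open>T\<^sub>N\<close>, where it is short.
  Comparing tiles of level \<open>N\<close> gives \<open>v \<in> \<Lambda>\<^sub>N\<close>. For a tile \<open>P\<close> of level \<open>k\<close> and \<open>v \<in> \<Lambda>\<^sub>k\<^sub>+\<^sub>1\<close>, the translate of the
  daughter \<open>(A, N, M)\<close> of \<open>P\<close> has its labelled endpoints in the same lattices, so it must again be a daughter
  of this kind; hence \<open>P + v\<close> is its parent and \<open>v \<in> \<Lambda>\<^sub>k\<close>. Descending, \<open>v\<close> lies in a fixed lattice, and being
  short it vanishes.
\<close>

section \<open>Tiles in complex coordinates\<close>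

definition apex :: "bool \<Rightarrow> complex" where
  "apex s = (if s then Complex (1/2) (1/2) else Complex (1/2) (-1/2))"

text \<open>\<open>d\<close> is the hypotenuse vector and \<open>s\<close> tells on which side of it
  the right angle lies, so \<open>d * apex s\<close> is the vector of the long leg.\<close>

definition tile_at :: "complex \<Rightarrow> complex \<Rightarrow> bool \<Rightarrow> tile" where
  "tile_at A d s = (A, A + d * apex s, A + d)"

lemma cnj_apex: "cnj (apex s) = apex (\<not> s)"
  by (simp add: apex_def complex_eq_iff)

lemma tile_at_inject: "tile_at A d s = tile_at A' d' s' \<longleftrightarrow> A = A' \<and> d = d' \<and> (d = 0 \<or> s = s')"
  by (auto simp: tile_at_def apex_def complex_eq_iff)

lemma hypotenuse_tile_at: "hypotenuse (tile_at A d s) = norm d"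
  by (simp add: tile_at_def dist_norm)

lemma is_tile_iff_tile_at: "is_tile t \<longleftrightarrow> (\<exists>A d s. d \<noteq> 0 \<and> t = tile_at A d s)"
proof
  obtain A C B where t: "t = (A, C, B)" by (cases t)
  define x where "x = A - C"
  define y where "y = B - C"
  assume "is_tile t"
  then have *: "x \<noteq> 0" "x \<bullet> y = 0" "norm x = norm y"
    by (auto simp: t x_def y_def dist_norm norm_minus_commute)
  have xn: "(Re x)\<^sup>2 + (Im x)\<^sup>2 = (Re y)\<^sup>2 + (Im y)\<^sup>2"
    using *(3) by (metis cmod_power2)
  have orth: "Re x * Re y + Im x * Im y = 0"
    using *(2) by (simp add: inner_complex_def)
  define m where "m = Re x * Im y - Im x * Re y"
  define n where "n = (Re x)\<^sup>2 + (Im x)\<^sup>2"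
  \<comment> \<open>Lagrange's identity: the determinant of perpendicular vectors of equal length is
    plus or minus the squared length.\<close>
  have "m\<^sup>2 = n * ((Re y)\<^sup>2 + (Im y)\<^sup>2) - (Re x * Re y + Im x * Im y)\<^sup>2"
    by (simp add: m_def n_def power2_eq_square algebra_simps)
  then have "m\<^sup>2 = n\<^sup>2"
    using orth xn by (simp add: n_def power2_eq_square)
  then have "m = n \<or> m = - n"
    by (simp add: power2_eq_iff)
  \<comment> \<open>\<open>cnj x * y\<close> has real part \<open>x \<bullet> y = 0\<close> and
    imaginary part \<open>m\<close>, so \<open>y\<close> is \<open>x\<close> turned by a right angle
    to one side or the other.\<close>
  then have "cnj x * (y - \<i> * x) = 0 \<or> cnj x * (y + \<i> * x) = 0"
    using orth by (auto simp: m_def n_def complex_eq_iff power2_eq_square algebra_simps)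
  then have "y = \<i> * x \<or> y = - \<i> * x"
    using *(1) by (auto simp: eq_neg_iff_add_eq_0)
  then obtain s where s: "y = (if s then - \<i> * x else \<i> * x)" by metis
  have "t = tile_at A (y - x) (\<not> s)"
    using s by (cases s) (auto simp: t tile_at_def apex_def complex_eq_iff x_def y_def field_simps)
  moreover have "y - x \<noteq> 0"
    using s *(1) by (auto simp: complex_eq_iff split: if_splits)
  ultimately show "\<exists>A d s. d \<noteq> 0 \<and> t = tile_at A d s" by blast
next
  assume "\<exists>A d s. d \<noteq> 0 \<and> t = tile_at A d s"
  then obtain A d s where d: "d \<noteq> 0" and t: "t = tile_at A d s" by blast
  have "apex s \<noteq> 0" by (simp add: apex_def complex_eq_iff)
  moreover have "dist A (A + d * apex s) = dist (A + d * apex s) (A + d)"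
  proof -
    have "dist (A + d * apex s) (A + d) = norm (d * (apex s - 1))"
      by (simp add: dist_norm algebra_simps)
    also have "\<dots> = norm d * norm (apex s)"
      by (simp add: norm_mult) (simp add: apex_def cmod_def)
    finally show ?thesis by (simp add: dist_norm norm_mult)
  qed
  moreover have "(- (d * apex s)) \<bullet> (d - d * apex s) = 0"
    by (simp add: inner_complex_def apex_def algebra_simps)
  ultimately show "is_tile t"
    using d by (simp add: t tile_at_def)
qed

lemma foot_tile: "d \<noteq> 0 \<Longrightarrow> foot (A + d * apex s) A (A + d) = A + d / 2"
proof -
  assume "d \<noteq> 0"
  then have "d \<bullet> d \<noteq> 0" by simp
  moreover have e: "(d * apex s) \<bullet> d = (d \<bullet> d) / 2"
    by (simp add: inner_complex_def apex_def field_simps)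
  moreover have "x / 2 / x = 1 / 2" if "x \<noteq> 0" for x :: real
    using that by simp
  ultimately have half: "(d * apex s) \<bullet> d / (d \<bullet> d) = 1 / 2"
    unfolding e by blast
  have "foot (A + d * apex s) A (A + d) = A + ((d * apex s) \<bullet> d / (d \<bullet> d)) *\<^sub>R d"
    by (simp add: foot_def)
  also have "\<dots> = A + d / 2"
    unfolding half by (simp add: scaleR_conv_of_real)
  finally show ?thesis .
qed

text \<open>By \<open>apex s + apex (\<not> s) = 1\<close> the short leg is
  \<open>d * apex (\<not> s)\<close>. The daughters' hypotenuses are half the long leg (twice), half
  the short leg (twice, in opposite directions) and the short leg.\<close>

lemma daughters_tile_at:
  assumes "d \<noteq> 0"
  shows "daughters (tile_at A d s) =
    {tile_at A (d * apex s / 2) (\<not> s),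
     tile_at (A + d * apex s / 2) (d * apex s / 2) (\<not> s),
     tile_at (A + d * apex s / 2) (d * apex (\<not> s) / 2) s,
     tile_at (A + d / 2) (- (d * apex (\<not> s) / 2)) s,
     tile_at (A + d * apex s) (d * apex (\<not> s)) (\<not> s)}"
proof -
  have 1: "(A, midpoint A (A + d / 2), midpoint A (A + d * apex s)) = tile_at A (d * apex s / 2) (\<not> s)"
    by (auto simp: tile_at_def midpoint_def apex_def complex_eq_iff field_simps)
  have 2: "(midpoint A (A + d * apex s), midpoint (A + d / 2) (A + d * apex s), A + d * apex s)
    = tile_at (A + d * apex s / 2) (d * apex s / 2) (\<not> s)"
    by (auto simp: tile_at_def midpoint_def apex_def complex_eq_iff field_simps)
  have 3: "(midpoint A (A + d * apex s), midpoint (A + d / 2) (A + d * apex s), A + d / 2)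
    = tile_at (A + d * apex s / 2) (d * apex (\<not> s) / 2) s"
    by (auto simp: tile_at_def midpoint_def apex_def complex_eq_iff field_simps)
  have 4: "(A + d / 2, midpoint A (A + d / 2), midpoint A (A + d * apex s))
    = tile_at (A + d / 2) (- (d * apex (\<not> s) / 2)) s"
    by (auto simp: tile_at_def midpoint_def apex_def complex_eq_iff field_simps)
  have 5: "(A + d * apex s, A + d / 2, A + d) = tile_at (A + d * apex s) (d * apex (\<not> s)) (\<not> s)"
    by (auto simp: tile_at_def apex_def complex_eq_iff field_simps)
  have "daughters (tile_at A d s) =
    {(A, midpoint A (A + d / 2), midpoint A (A + d * apex s)),
     (midpoint A (A + d * apex s), midpoint (A + d / 2) (A + d * apex s), A + d * apex s),
     (midpoint A (A + d * apex s), midpoint (A + d / 2) (A + d * apex s), A + d / 2),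
     (A + d / 2, midpoint A (A + d / 2), midpoint A (A + d * apex s)),
     (A + d * apex s, A + d / 2, A + d)}"
    by (simp add: tile_at_def Let_def foot_tile[OF assms])
  then show ?thesis unfolding 1 2 3 4 5 .
qed

subsection \<open>Lattices\<close>

definition gauss :: "complex set" where
  "gauss = {z. Re z \<in> \<int> \<and> Im z \<in> \<int>}"

definition units :: "complex set" where
  "units = {1, -1, \<i>, -\<i>}"

text \<open>A fractional ideal of the Gaussian integers. These lattices grow with \<open>k\<close>,
  each having index 2 in the next.\<close>

definition lattice :: "nat \<Rightarrow> complex set" where
  "lattice k = {z. z * (1 + \<i>) ^ k \<in> gauss}"

lemma gauss_add: "x \<in> gauss \<Longrightarrow> y \<in> gauss \<Longrightarrow> x + y \<in> gauss"
  and gauss_diff: "x \<in> gauss \<Longrightarrow> y \<in> gauss \<Longrightarrow> x - y \<in> gauss"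
  and gauss_mult: "x \<in> gauss \<Longrightarrow> y \<in> gauss \<Longrightarrow> x * y \<in> gauss"
  and gauss_0: "0 \<in> gauss"
  by (simp_all add: gauss_def)

lemma one_plus_i_in_gauss: "1 + \<i> \<in> gauss"
  by (simp add: gauss_def)

lemma one_plus_i_neq_0: "1 + \<i> \<noteq> 0"
  by (simp add: complex_eq_iff)

lemma one_plus_i_power_in_gauss: "(1 + \<i>) ^ n \<in> gauss"
  by (induction n) (auto intro: gauss_mult one_plus_i_in_gauss, simp add: gauss_def)

lemma gauss_mult_power:
  assumes "x \<in> gauss"
  shows "x * (1 + \<i>) ^ n \<in> gauss"
  by (intro gauss_mult assms one_plus_i_power_in_gauss)

lemma units_subset_gauss: "units \<subseteq> gauss"
  by (auto simp: units_def gauss_def)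

lemma norm_units: "u \<in> units \<Longrightarrow> norm u = 1"
  by (auto simp: units_def)

lemma lattice_add: "x \<in> lattice k \<Longrightarrow> y \<in> lattice k \<Longrightarrow> x + y \<in> lattice k"
  and lattice_diff: "x \<in> lattice k \<Longrightarrow> y \<in> lattice k \<Longrightarrow> x - y \<in> lattice k"
  by (auto simp: lattice_def distrib_right left_diff_distrib intro: gauss_add gauss_diff)

lemma lattice_add_right_iff: "y \<in> lattice k \<Longrightarrow> x + y \<in> lattice k \<longleftrightarrow> x \<in> lattice k"
  using lattice_add[of x k y] lattice_diff[of "x + y" k y] by auto

lemma lattice_mono: "j \<le> k \<Longrightarrow> x \<in> lattice j \<Longrightarrow> x \<in> lattice k"
  using gauss_mult_power[of "x * (1 + \<i>) ^ j" "k - j"]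
  by (simp add: lattice_def mult.assoc power_add[symmetric])

text \<open>Scaled by \<open>(1 + \<i>) ^ k\<close>, the vector becomes a Gaussian integer of
  modulus below 1. This is what finally kills a short period.\<close>

lemma lattice_small_eq_0:
  assumes "v \<in> lattice k" and "norm v * sqrt 2 ^ k < 1"
  shows "v = 0"
proof -
  define z where "z = v * (1 + \<i>) ^ k"
  have "norm (1 + \<i>) = sqrt 2" by (simp add: cmod_def)
  then have "norm z < 1"
    using assms(2) by (simp add: z_def norm_mult norm_power)
  then have "\<bar>Re z\<bar> < 1" "\<bar>Im z\<bar> < 1"
    using abs_Re_le_cmod[of z] abs_Im_le_cmod[of z] by linarith+
  moreover have "Re z \<in> \<int>" "Im z \<in> \<int>"
    using assms(1) by (simp_all add: lattice_def gauss_def z_def)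
  ultimately have "z = 0"
    by (simp add: Ints_nonzero_abs_less1 complex_eq_iff)
  then show ?thesis by (simp add: z_def one_plus_i_neq_0)
qed

text \<open>The second conjunct makes \<open>d\<close> one of the four shortest nonzero vectors of
  \<open>lattice k\<close>.\<close>

definition on_grid :: "nat \<Rightarrow> complex \<Rightarrow> complex \<Rightarrow> bool" where
  "on_grid k A d \<longleftrightarrow> A \<in> lattice k \<and> d * (1 + \<i>) ^ k \<in> units"

lemma on_gridD:
  assumes "on_grid k A d"
  shows "A \<in> lattice k" and "d \<in> lattice k" and "norm d = (1 / sqrt 2) ^ k" and "d \<noteq> 0"
proof -
  show "A \<in> lattice k" "d \<in> lattice k"
    using assms units_subset_gauss by (auto simp: on_grid_def lattice_def)
  have "norm (d * (1 + \<i>) ^ k) = 1"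
    using assms norm_units by (simp add: on_grid_def)
  moreover have "norm (1 + \<i>) = sqrt 2" by (simp add: cmod_def)
  ultimately show *: "norm d = (1 / sqrt 2) ^ k"
    by (simp add: norm_mult norm_power field_simps)
  show "d \<noteq> 0"
    using * by auto
qed

text \<open>Up to a unit, 2 is \<open>(1 + \<i>) ^ 2\<close>. Halving thus costs two levels and
  passing to a leg one, so half a leg lies three levels deeper.\<close>

lemma one_plus_i_cube: "(1 + \<i>) ^ 3 = 2 * \<i> * (1 + \<i>)"
  by (simp add: power3_eq_cube complex_eq_iff)

lemma one_plus_i_square: "(1 + \<i>)\<^sup>2 = 2 * \<i>"
  by (simp add: power2_eq_square complex_eq_iff)

text \<open>\<open>apex s\<close> is a unit divided by \<open>1 + \<i>\<close>.\<close>

lemma unit_apex: "u \<in> units \<Longrightarrow> u * apex s * (1 + \<i>) \<in> units"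
  by (auto simp: units_def apex_def complex_eq_iff)

lemma unit_i: "u \<in> units \<Longrightarrow> \<i> * u \<in> units"
  and unit_minus: "u \<in> units \<Longrightarrow> - u \<in> units"
  by (auto simp: units_def complex_eq_iff)

lemma half_not_Ints: "(1/2 :: real) \<notin> \<int>" "(-1/2 :: real) \<notin> \<int>" "-(1/2 :: real) \<notin> \<int>"
proof -
  show "(1/2 :: real) \<notin> \<int>"
  proof
    assume "(1/2 :: real) \<in> \<int>"
    then obtain n where "(1/2 :: real) = of_int n" by (elim Ints_cases)
    then have "real_of_int (2 * n) = 1" by simp
    then have "2 * n = 1" by linarith
    then show False by presburger
  qed
  then show "(-1/2 :: real) \<notin> \<int>" "-(1/2 :: real) \<notin> \<int>"
    using Ints_minus[of "-(1/2) :: real"] by auto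
qed

text \<open>Both coordinates are 1/2 up to sign. This fact and its companion below are behind every
  exclusion of a vertex from a lattice.\<close>

lemma unit_apex_notin_gauss: "u \<in> units \<Longrightarrow> u * apex s \<notin> gauss"
  using half_not_Ints by (auto simp: units_def apex_def gauss_def)

lemma unit_half_notin_gauss: "u \<in> units \<Longrightarrow> u * (1 + \<i>) / 2 \<notin> gauss"
  using half_not_Ints by (auto simp: units_def gauss_def)

context
  fixes k A d
  assumes grid: "on_grid k A d"
begin

lemma half_leg_unit: "(d * apex s / 2) * (1 + \<i>) ^ (k + 3) \<in> units"
proof -
  have "(d * apex s / 2) * (1 + \<i>) ^ (k + 3) = \<i> * (d * (1 + \<i>) ^ k * apex s * (1 + \<i>))"
    by (simp only: power_add one_plus_i_cube) (simp add: field_simps)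
  then show ?thesis using grid by (simp only: on_grid_def unit_apex unit_i)
qed

lemma half_leg_lattice: "d * apex s / 2 \<in> lattice (k + 3)"
  using half_leg_unit units_subset_gauss by (auto simp: lattice_def)

lemma leg_unit: "d * apex s * (1 + \<i>) ^ (k + 1) \<in> units"
proof -
  have "d * apex s * (1 + \<i>) ^ (k + 1) = d * (1 + \<i>) ^ k * apex s * (1 + \<i>)"
    by simp
  then show ?thesis using grid by (simp only: on_grid_def unit_apex)
qed

lemma leg_lattice: "d * apex s \<in> lattice (k + 1)"
  using leg_unit units_subset_gauss by (auto simp: lattice_def)

lemma half_hypotenuse_lattice: "d / 2 \<in> lattice (k + 2)"
proof -
  have "(d / 2) * (1 + \<i>) ^ (k + 2) = \<i> * (d * (1 + \<i>) ^ k)"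
    by (simp only: power_add one_plus_i_square) simp
  then have "(d / 2) * (1 + \<i>) ^ (k + 2) \<in> gauss"
    using grid unit_i units_subset_gauss by (metis on_grid_def subsetD)
  then show ?thesis by (simp only: lattice_def mem_Collect_eq)
qed

text \<open>At scale \<open>k + 2\<close> half a leg is a unit times an apex, so the midpoint M of
  the leg first appears in \<open>lattice (k + 3)\<close>.\<close>

lemma half_leg_notin_lattice: "A + d * apex s / 2 \<notin> lattice (k + 2)"
proof -
  have "(d * apex s / 2) * (1 + \<i>) ^ (k + 2) = (\<i> * (d * (1 + \<i>) ^ k)) * apex s"
    by (simp only: power_add one_plus_i_square) simp
  then have "d * apex s / 2 \<notin> lattice (k + 2)"
    using grid unit_apex_notin_gauss[OF unit_i] by (metis on_grid_def lattice_def mem_Collect_eq)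
  moreover have "A \<in> lattice (k + 2)"
    using grid lattice_mono[of k "k + 2"] by (simp add: on_grid_def)
  ultimately show ?thesis
    using lattice_add_right_iff by (metis add.commute)
qed

text \<open>Likewise the foot F first appears in \<open>lattice (k + 2)\<close>.\<close>

lemma half_hypotenuse_notin_lattice: "A + d / 2 \<notin> lattice (k + 1)"
proof -
  have "(d / 2) * (1 + \<i>) ^ (k + 1) = (d * (1 + \<i>) ^ k) * (1 + \<i>) / 2"
    by simp
  then have "d / 2 \<notin> lattice (k + 1)"
    using grid unit_half_notin_gauss by (simp only: on_grid_def lattice_def mem_Collect_eq) blast
  moreover have "A \<in> lattice (k + 1)"
    using grid lattice_mono[of k "k + 1"] by (simp add: on_grid_def)
  ultimately show ?thesis
    using lattice_add_right_iff by (metis add.commute)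
qed

text \<open>Four daughters descend three levels and the fifth one level, matching the factors
  \<open>2 powr (-3/2)\<close> and \<open>2 powr (-1/2)\<close>. The free \<open>s'\<close> in the
  second claim covers both daughters that start at M.\<close>

lemma on_grid_daughters:
  "on_grid (k + 3) A (d * apex s / 2)"
  "on_grid (k + 3) (A + d * apex s / 2) (d * apex s' / 2)"
  "on_grid (k + 3) (A + d / 2) (- (d * apex s / 2))"
  "on_grid (k + 1) (A + d * apex s) (d * apex s')"
proof -
  have A: "A \<in> lattice (k + m)" for m
    using grid lattice_mono[of k "k + m"] by (simp add: on_grid_def)
  have h: "d / 2 \<in> lattice (k + 3)"
    using half_hypotenuse_lattice lattice_mono[of "k + 2" "k + 3"] by simp
  show "on_grid (k + 3) A (d * apex s / 2)"
    "on_grid (k + 3) (A + d * apex s / 2) (d * apex s' / 2)"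
    "on_grid (k + 1) (A + d * apex s) (d * apex s')"
    unfolding on_grid_def
    by (intro conjI A half_leg_unit leg_unit lattice_add half_leg_lattice leg_lattice)+
  show "on_grid (k + 3) (A + d / 2) (- (d * apex s / 2))"
    unfolding on_grid_def using unit_minus[OF half_leg_unit] A h
    by (intro conjI lattice_add) simp_all
qed

end

text \<open>All tiles reachable from the root by subdivision, whatever the order of the cuts. The
  index is the level, that is the size, and not the number of cuts.\<close>

inductive descendant :: "nat \<Rightarrow> tile \<Rightarrow> bool" where
  root: "descendant 0 (tile_at 0 1 True)"
| d1: "descendant k (tile_at A d s) \<Longrightarrow> descendant (k + 3) (tile_at A (d * apex s / 2) (\<not> s))"
| d2: "descendant k (tile_at A d s) \<Longrightarrow>
    descendant (k + 3) (tile_at (A + d * apex s / 2) (d * apex s / 2) (\<not> s))"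
| d3: "descendant k (tile_at A d s) \<Longrightarrow>
    descendant (k + 3) (tile_at (A + d * apex s / 2) (d * apex (\<not> s) / 2) s)"
| d4: "descendant k (tile_at A d s) \<Longrightarrow>
    descendant (k + 3) (tile_at (A + d / 2) (- (d * apex (\<not> s) / 2)) s)"
| d5: "descendant k (tile_at A d s) \<Longrightarrow>
    descendant (k + 1) (tile_at (A + d * apex s) (d * apex (\<not> s)) (\<not> s))"

lemma descendant_on_grid:
  assumes "descendant k t"
  shows "\<exists>A d s. t = tile_at A d s \<and> on_grid k A d"
  using assms
proof induction
  case root
  then show ?case
    by (intro exI[of _ 0] exI[of _ 1] exI[of _ True])
      (simp add: on_grid_def lattice_def gauss_def units_def)
qed (metis tile_at_inject on_grid_daughters on_gridD(4))+

lemma descendant_tile_at_on_grid: "descendant k (tile_at A d s) \<Longrightarrow> on_grid k A d"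
  using descendant_on_grid tile_at_inject by metis

lemma descendant_hypotenuse: "descendant k t \<Longrightarrow> hypotenuse t = (1 / sqrt 2) ^ k"
  using descendant_on_grid on_gridD(3) hypotenuse_tile_at by metis

lemma descendant_daughters:
  assumes "descendant k t" and "u \<in> daughters t"
  shows "descendant (k + 1) u \<or> descendant (k + 3) u"
proof -
  obtain A d s where t: "t = tile_at A d s" "d \<noteq> 0"
    using descendant_on_grid[OF assms(1)] on_gridD(4) by blast
  show ?thesis
    using assms descendant.intros(2-)[of k A d s] by (auto simp: t daughters_tile_at)
qed

text \<open>A first daughter is told apart from its siblings and from the fifth daughter of a smaller tile
  by which of the lattices contain its endpoints.\<close>

lemma translated_first_daughter:
  assumes "descendant k (tile_at A d s)" and v: "v \<in> lattice (k + 1)"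
    and tr: "descendant (k + 3) (tile_at (A + v) (d * apex s / 2) (\<not> s))"
  shows "v \<in> lattice k" and "descendant k (tile_at (A + v) d s)"
proof -
  have g: "on_grid k A d"
    using assms(1) by (rule descendant_tile_at_on_grid)
  define b where "b = d * apex s / 2"
  have b: "b \<noteq> 0" using on_gridD(4)[OF on_grid_daughters(1)[OF g]] by (simp add: b_def)
  \<comment> \<open>The far endpoint is the midpoint of a leg, shifted within
    \<open>lattice (k + 1)\<close>, and so stays outside \<open>lattice (k + 2)\<close>; the near
    endpoint stays in \<open>lattice (k + 1)\<close>. Each of the other kinds of daughter violates
    one of these.\<close>
  have B: "A + v + b \<notin> lattice (k + 2)"
    using half_leg_notin_lattice[OF g] lattice_add_right_iff[of v "k + 2" "A + b"]
      lattice_mono[where k = "k + 2", OF _ v] by (simp add: b_def algebra_simps)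
  have A: "A + v \<in> lattice (k + 1)"
    using on_gridD(1)[OF g] v lattice_mono[of k "k + 1" A] by (intro lattice_add) auto
  have "\<exists>A' d' s'. descendant k (tile_at A' d' s') \<and>
      tile_at (A + v) b (\<not> s) = tile_at A' (d' * apex s' / 2) (\<not> s')"
    using tr unfolding b_def[symmetric]
  proof cases
    case (d1 k' A' d' s')
    then show ?thesis by auto
  next
    \<comment> \<open>The second daughter ends at the right angle of its parent, a point of
      \<open>lattice (k + 1)\<close>.\<close>
    case (d2 k' A' d' s')
    then have "on_grid k A' d'" and e: "A + v = A' + d' * apex s' / 2" "b = d' * apex s' / 2"
      using descendant_tile_at_on_grid by (auto simp: tile_at_inject)
    moreover have e: "A + v + b = A' + d' * apex s'"
      unfolding e by simp
    ultimately have False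
      using B[unfolded e] leg_lattice[of k A' d' s'] on_gridD(1)[of k A' d']
        lattice_mono[of k "k + 2"] lattice_mono[of "k + 1" "k + 2"]
      by (auto intro!: lattice_add)
    then show ?thesis ..
  next
    \<comment> \<open>The third daughter ends at the foot F, which lies in
      \<open>lattice (k + 2)\<close>.\<close>
    case (d3 k' A' d' s')
    then have "on_grid k A' d'" and e: "A + v + b = A' + d' * apex s' / 2 + d' * apex (\<not> s') / 2"
      using descendant_tile_at_on_grid by (auto simp: tile_at_inject)
    moreover have "A + v + b = A' + d' / 2"
      unfolding e by (simp add: apex_def complex_eq_iff field_simps)
    ultimately have False
      using B half_hypotenuse_lattice[of k A' d'] on_gridD(1)[of k A' d']
        lattice_mono[of k "k + 2"]
      by (auto intro!: lattice_add)
    then show ?thesis ..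
  next
    \<comment> \<open>The fourth daughter starts at F, outside
      \<open>lattice (k + 1)\<close>.\<close>
    case (d4 k' A' d' s')
    then have "on_grid k A' d'" "A + v = A' + d' / 2"
      using descendant_tile_at_on_grid by (auto simp: tile_at_inject)
    then have False
      using A half_hypotenuse_notin_lattice[of k A' d'] by simp
    then show ?thesis ..
  next
    \<comment> \<open>Here the parent has level \<open>k + 2\<close>, and the daughter ends at an
      acute vertex of that parent.\<close>
    case (d5 k' A' d' s')
    then have "on_grid (k + 2) A' d'" and e: "A + v + b = A' + d' * apex s' + d' * apex (\<not> s')"
      using descendant_tile_at_on_grid by (auto simp: tile_at_inject)
    moreover have "A + v + b = A' + d'"
      unfolding e by (simp add: apex_def complex_eq_iff field_simps)
    ultimately have False
      using B on_gridD(1,2)[of "k + 2" A' d'] by (auto intro!: lattice_add)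
    then show ?thesis ..
  qed (use b in \<open>auto simp: tile_at_inject\<close>)
  then obtain A' d' s' where *: "descendant k (tile_at A' d' s')"
      "tile_at (A + v) b (\<not> s) = tile_at A' (d' * apex s' / 2) (\<not> s')"
    by blast
  then have "A' = A + v" "s' = s" "d * apex s = d' * apex s'"
    using b by (auto simp: tile_at_inject b_def)
  moreover have "apex s \<noteq> 0" by (simp add: apex_def complex_eq_iff)
  ultimately have "A' = A + v" "s' = s" "d' = d"
    by auto
  then show "descendant k (tile_at (A + v) d s)" using *(1) by simp
  then have "A + v \<in> lattice k"
    using descendant_tile_at_on_grid on_gridD(1) by blast
  then show "v \<in> lattice k"
    using lattice_add_right_iff[OF on_gridD(1)[OF g], of v] by (simp add: add.commute)
qed

subsection \<open>Subdivisions of the root tile\<close>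

abbreviation root_tile :: tile where
  "root_tile \<equiv> tile_at 0 1 True"

lemma power_inv_sqrt2_le_iff: "(1 / sqrt 2) ^ j \<le> (1 / sqrt 2) ^ k \<longleftrightarrow> k \<le> j"
  by (rule power_decreasing_iff) auto

lemma descendant_level_unique:
  assumes "descendant k t" "descendant k' t'" "hypotenuse t = hypotenuse t'"
  shows "k = k'"
proof -
  have "(1 / sqrt 2) ^ k = (1 / sqrt 2) ^ k'"
    using assms descendant_hypotenuse by metis
  then show ?thesis
    using power_inv_sqrt2_le_iff by (metis le_antisym order_refl)
qed

lemma fifth_daughter_descendant:
  assumes "descendant k t"
  obtains u where "u \<in> daughters t" "descendant (Suc k) u"
proof -
  obtain A d s where "t = tile_at A d s" "d \<noteq> 0"
    using descendant_on_grid[OF assms(1)] on_gridD(4) by blast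
  then have "tile_at (A + d * apex s) (d * apex (\<not> s)) (\<not> s) \<in> daughters t"
    "descendant (Suc k) (tile_at (A + d * apex s) (d * apex (\<not> s)) (\<not> s))"
    using descendant.d5[of k A d s] assms by (simp_all add: daughters_tile_at)
  then show thesis by (rule that)
qed

lemma subdivision_0: "subdivision t 0 = {t}"
  by (simp add: subdivision_def)

lemma subdivision_Suc: "subdivision t (Suc n) = subdivide_largest (subdivision t n)"
  by (simp add: subdivision_def)

text \<open>Hypotenuses decrease strictly with the level, so the largest tiles are exactly those of
  the lowest level present.\<close>

lemma subdivide_largest_levels:
  assumes "\<And>t. t \<in> S \<Longrightarrow> \<exists>k\<ge>n. descendant k t" and "t\<^sub>0 \<in> S" "descendant n t\<^sub>0"
  shows "subdivide_largest S = (\<Union>t\<in>S. if descendant n t then daughters t else {t})"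
proof -
  have "(\<forall>u\<in>S. hypotenuse u \<le> hypotenuse t) \<longleftrightarrow> descendant n t" if "t \<in> S" for t
  proof -
    obtain k where k: "k \<ge> n" "descendant k t" using assms(1) \<open>t \<in> S\<close> by blast
    have "(\<forall>u\<in>S. hypotenuse u \<le> hypotenuse t) \<longleftrightarrow> k \<le> n"
    proof
      assume "\<forall>u\<in>S. hypotenuse u \<le> hypotenuse t"
      then show "k \<le> n"
        using assms(2,3) k(2) by (metis descendant_hypotenuse power_inv_sqrt2_le_iff)
    next
      assume "k \<le> n"
      then show "\<forall>u\<in>S. hypotenuse u \<le> hypotenuse t"
        using assms(1) k(2) by (metis descendant_hypotenuse power_inv_sqrt2_le_iff order_trans)
    qed
    also have "\<dots> \<longleftrightarrow> descendant n t"
      using k descendant_level_unique[OF k(2), of n t] by auto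
    finally show ?thesis .
  qed
  then show ?thesis
    unfolding subdivide_largest_def by (intro SUP_cong refl) simp
qed

text \<open>Cutting the tiles of level \<open>n\<close> produces levels \<open>n + 1\<close> and
  \<open>n + 3\<close>, which moves the window of levels up by one; fifth daughters keep its lower
  end occupied.\<close>

lemma subdivision_root_levels:
  "(\<forall>t\<in>subdivision root_tile n. \<exists>k. n \<le> k \<and> k \<le> n + 2 \<and> descendant k t) \<and>
   (\<exists>t\<in>subdivision root_tile n. descendant n t)"
proof (induction n)
  case 0
  then show ?case using descendant.root by (auto simp: subdivision_0)
next
  case (Suc n)
  define S where "S = subdivision root_tile n"
  obtain t\<^sub>0 where t0: "t\<^sub>0 \<in> S" "descendant n t\<^sub>0" using Suc by (auto simp: S_def)
  have lev: "\<exists>k. n \<le> k \<and> k \<le> n + 2 \<and> descendant k t" if "t \<in> S" for t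
    using Suc that by (auto simp: S_def)
  have *: "subdivision root_tile (Suc n) = (\<Union>t\<in>S. if descendant n t then daughters t else {t})"
    unfolding subdivision_Suc S_def[symmetric]
    by (rule subdivide_largest_levels[OF _ t0]) (use lev in blast)
  have "\<exists>k. Suc n \<le> k \<and> k \<le> Suc n + 2 \<and> descendant k u"
    if u: "u \<in> subdivision root_tile (Suc n)" for u
  proof -
    obtain t where t: "t \<in> S" "u \<in> (if descendant n t then daughters t else {t})"
      using u unfolding * by blast
    show ?thesis
    proof (cases "descendant n t")
      case True
      then have "descendant (n + 1) u \<or> descendant (n + 3) u"
        using t descendant_daughters by simp
      then show ?thesis
        by (metis Suc_eq_plus1 add.commute add_Suc_right eval_nat_numeral(3) le_add1 le_refl
            numeral_2_eq_2 plus_1_eq_Suc add_2_eq_Suc')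
    next
      case False
      then have "u = t" using t by simp
      moreover obtain k where "n \<le> k" "k \<le> n + 2" "descendant k t" using lev t by blast
      ultimately show ?thesis using False
        by (intro exI[of _ k]) (auto simp: le_less Suc_le_eq)
    qed
  qed
  moreover have "\<exists>u\<in>subdivision root_tile (Suc n). descendant (Suc n) u"
  proof -
    obtain u where "u \<in> daughters t\<^sub>0" "descendant (Suc n) u"
      using fifth_daughter_descendant[OF t0(2)] by blast
    then show ?thesis unfolding * using t0 by (intro bexI[of _ u]) auto
  qed
  ultimately show ?case by blast
qed

lemma subdivision_root_level:
  assumes "t \<in> subdivision root_tile n"
  obtains k where "n \<le> k" "k \<le> n + 2" "descendant k t"
  using assms subdivision_root_levels by blast

lemma subdivision_root_Suc:
  "subdivision root_tile (Suc n) =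
    (\<Union>t\<in>subdivision root_tile n. if descendant n t then daughters t else {t})"
proof -
  obtain t\<^sub>0 where "t\<^sub>0 \<in> subdivision root_tile n" "descendant n t\<^sub>0"
    using subdivision_root_levels by blast
  then show ?thesis
    unfolding subdivision_Suc
    by (intro subdivide_largest_levels) (use subdivision_root_levels in blast)+
qed

text \<open>A tile remains uncut until the stage reaches its level.\<close>

lemma subdivision_root_persist:
  assumes "t \<in> subdivision root_tile n" "descendant m t" "n \<le> n'" "n' \<le> m"
  shows "t \<in> subdivision root_tile n'"
  using assms(3,4)
proof (induction n' rule: dec_induct)
  case base
  then show ?case using assms by simp
next
  case (step n')
  then have "\<not> descendant n' t"
    using descendant_level_unique[OF assms(2), of n' t] by auto
  then show ?case
    unfolding subdivision_root_Suc using step by auto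
qed

lemma daughters_subdivision_root:
  "t \<in> subdivision root_tile n \<Longrightarrow> descendant n t \<Longrightarrow> u \<in> daughters t \<Longrightarrow>
    u \<in> subdivision root_tile (Suc n)"
  unfolding subdivision_root_Suc by (rule UN_I) auto

text \<open>A parent present at the stage equal to its level is cut there, and the daughter then
  persists until the stage equal to its own level.\<close>

lemma descendant_in_subdivision_root:
  assumes "descendant k t"
  shows "t \<in> subdivision root_tile k"
  using assms
proof induction
  case root
  then show ?case by (simp add: subdivision_0)
next
  case (d1 k A d s)
  then have "tile_at A (d * apex s / 2) (\<not> s) \<in> subdivision root_tile (Suc k)"
    using on_gridD(4)[OF descendant_tile_at_on_grid] by (intro daughters_subdivision_root) (auto simp: daughters_tile_at)
  then show ?case using descendant.d1[OF d1.hyps] by (rule subdivision_root_persist) auto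
next
  case (d2 k A d s)
  then have "tile_at (A + d * apex s / 2) (d * apex s / 2) (\<not> s) \<in> subdivision root_tile (Suc k)"
    using on_gridD(4)[OF descendant_tile_at_on_grid] by (intro daughters_subdivision_root) (auto simp: daughters_tile_at)
  then show ?case using descendant.d2[OF d2.hyps] by (rule subdivision_root_persist) auto
next
  case (d3 k A d s)
  then have "tile_at (A + d * apex s / 2) (d * apex (\<not> s) / 2) s \<in> subdivision root_tile (Suc k)"
    using on_gridD(4)[OF descendant_tile_at_on_grid] by (intro daughters_subdivision_root) (auto simp: daughters_tile_at)
  then show ?case using descendant.d3[OF d3.hyps] by (rule subdivision_root_persist) auto
next
  case (d4 k A d s)
  then have "tile_at (A + d / 2) (- (d * apex (\<not> s) / 2)) s \<in> subdivision root_tile (Suc k)"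
    using on_gridD(4)[OF descendant_tile_at_on_grid] by (intro daughters_subdivision_root) (auto simp: daughters_tile_at)
  then show ?case using descendant.d4[OF d4.hyps] by (rule subdivision_root_persist) auto
next
  case (d5 k A d s)
  then have "tile_at (A + d * apex s) (d * apex (\<not> s)) (\<not> s) \<in> subdivision root_tile (Suc k)"
    using on_gridD(4)[OF descendant_tile_at_on_grid] by (intro daughters_subdivision_root) (auto simp: daughters_tile_at)
  then show ?case by simp
qed

section \<open>Daughters cover their parent and stay inside it\<close>

lemma convex_hull_split_midpoint:
  fixes a b c :: "'a::real_vector"
  shows "convex hull {a, b, c} \<subseteq>
    convex hull {a, b, midpoint a c} \<union> convex hull {midpoint a c, b, c}"
proof
  fix x assume "x \<in> convex hull {a, b, c}"
  then obtain u v w where x: "x = u *\<^sub>R a + v *\<^sub>R b + w *\<^sub>R c" and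
    p: "0 \<le> u" "0 \<le> v" "0 \<le> w" "u + v + w = 1"
    unfolding convex_hull_3 by blast
  have m: "(2 * r) *\<^sub>R midpoint a c = r *\<^sub>R a + r *\<^sub>R c" for r
    by (simp add: midpoint_def scaleR_add_right)
  show "x \<in> convex hull {a, b, midpoint a c} \<union> convex hull {midpoint a c, b, c}"
  \<comment> \<open>The smaller of the weights at \<open>a\<close> and \<open>c\<close> is
    transferred, doubled, to the midpoint.\<close>
  proof (cases "w \<le> u")
    case True
    have "x = (u - w) *\<^sub>R a + v *\<^sub>R b + (2 * w) *\<^sub>R midpoint a c"
      unfolding m by (simp add: x algebra_simps)
    then have "x \<in> convex hull {a, b, midpoint a c}"
      unfolding convex_hull_3 using p True by force
    then show ?thesis ..
  next
    case False
    have "x = (2 * u) *\<^sub>R midpoint a c + v *\<^sub>R b + (w - u) *\<^sub>R c"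
      unfolding m by (simp add: x algebra_simps)
    then have "x \<in> convex hull {midpoint a c, b, c}"
      unfolding convex_hull_3 using p False by force
    then show ?thesis ..
  qed
qed

text \<open>In an isosceles tile the foot is the midpoint of the hypotenuse. Midpoints alone then
  determine the daughters, which makes subdivision commute with similarities.\<close>

lemma daughters_midpoint:
  assumes "is_tile (A, C, B)"
  shows "daughters (A, C, B) =
    (let F = midpoint A B; M = midpoint A C; N = midpoint A F; K = midpoint F C
     in {(A, N, M), (M, K, C), (M, K, F), (F, N, M), (C, F, B)})"
proof -
  obtain d s where "d \<noteq> 0" "C = A + d * apex s" "B = A + d"
    using assms unfolding is_tile_iff_tile_at by (auto simp: tile_at_def)
  then have "foot C A B = midpoint A B"
    by (simp add: foot_tile midpoint_def scaleR_conv_of_real field_simps)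
  then show ?thesis by simp
qed

text \<open>Four cuts along medians suffice: ACB at F, AFC at M, AMF at N and FMC at K.\<close>

lemma region_subset_daughters:
  assumes "is_tile t"
  shows "region t \<subseteq> (\<Union>u\<in>daughters t. region u)"
proof -
  obtain A C B where t: "t = (A, C, B)" by (cases t)
  define F where "F = midpoint A B"
  define M where "M = midpoint A C"
  define N where "N = midpoint A F"
  define K where "K = midpoint F C"
  have d: "daughters t = {(A, N, M), (M, K, C), (M, K, F), (F, N, M), (C, F, B)}"
    using daughters_midpoint[of A C B] assms by (simp add: t F_def M_def N_def K_def Let_def)
  have "convex hull {A, C, B} \<subseteq> convex hull {A, F, C} \<union> convex hull {C, F, B}"
    using convex_hull_split_midpoint[of A C B] by (simp add: F_def insert_commute)
  also have "convex hull {A, F, C} \<subseteq> convex hull {A, M, F} \<union> convex hull {F, M, C}"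
    using convex_hull_split_midpoint[of A F C] by (simp add: M_def insert_commute)
  also have "convex hull {A, M, F} \<subseteq> convex hull {A, N, M} \<union> convex hull {F, N, M}"
    using convex_hull_split_midpoint[of A M F] by (simp add: N_def insert_commute)
  also have "convex hull {F, M, C} \<subseteq> convex hull {M, K, F} \<union> convex hull {M, K, C}"
    using convex_hull_split_midpoint[of F M C] by (simp add: K_def insert_commute)
  finally show ?thesis unfolding d by (auto simp: t)
qed

text \<open>Every vertex of a daughter is an iterated midpoint of A, C and B, hence in their convex
  hull.\<close>

lemma region_daughter_subset:
  assumes "is_tile t" "u \<in> daughters t"
  shows "region u \<subseteq> region t"
proof -
  obtain A C B where t: "t = (A, C, B)" by (cases t)
  define R where "R = convex hull {A, C, B}"
  have mid: "midpoint x y \<in> R" if "x \<in> R" "y \<in> R" for x y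
    using that convex_convex_hull[of "{A, C, B}"] unfolding R_def[symmetric]
    by (meson closed_segment_subset midpoint_in_closed_segment subsetD)
  have "A \<in> R" "C \<in> R" "B \<in> R" by (auto simp: R_def intro: hull_inc)
  then have "\<exists>x y z. u = (x, y, z) \<and> {x, y, z} \<subseteq> R"
    using assms(2) daughters_midpoint[OF assms(1)[unfolded t]]
    unfolding t by (auto simp: Let_def mid simp del: daughters.simps)
  then obtain x y z where "u = (x, y, z)" "{x, y, z} \<subseteq> R" by blast
  then show ?thesis
    using hull_minimal[of "{x, y, z}" R convex] by (simp add: t R_def)
qed

lemma descendant_is_tile: "descendant k t \<Longrightarrow> is_tile t"
  using descendant_on_grid on_gridD(4) is_tile_iff_tile_at by metis

lemma region_root_covered: "region root_tile \<subseteq> (\<Union>t\<in>subdivision root_tile n. region t)"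
proof (induction n)
  case 0
  then show ?case by (simp add: subdivision_0)
next
  case (Suc n)
  have "region t \<subseteq> (\<Union>u\<in>subdivision root_tile (Suc n). region u)"
    if t: "t \<in> subdivision root_tile n" for t
  proof (cases "descendant n t")
    case True
    then show ?thesis
      using region_subset_daughters[OF descendant_is_tile] daughters_subdivision_root[OF t] by blast
  next
    case False
    then show ?thesis using t unfolding subdivision_root_Suc by auto
  qed
  with Suc show ?case by blast
qed

lemma map_tile_translate_tile_at: "map_tile (\<lambda>z. z + v) (tile_at A d s) = tile_at (A + v) d s"
  by (simp add: tile_at_def)

text \<open>A translation that maps the tiles of the \<open>N\<close>-th subdivision near a descendant \<open>q\<close> to tiles
  does the same for all earlier subdivisions, one step at a time: the parent is recovered from its
  first daughter, and its translate shows that the vector lies in the next coarser lattice.\<close>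

lemma translation_descent:
  assumes q: "descendant k\<^sub>0 q" and "k\<^sub>0 \<le> N"
    and inv: "\<And>t. t \<in> subdivision root_tile N \<Longrightarrow> region t \<subseteq> region q \<Longrightarrow>
      map_tile (\<lambda>z. z + v) t \<in> subdivision root_tile N"
  shows "v \<in> lattice k\<^sub>0"
proof -
  \<comment> \<open>Following fifth daughters from \<open>q\<close> yields a tile of every level
    inside \<open>q\<close>, so the induction below always has a tile to compare.\<close>
  have ex: "\<exists>t. descendant k t \<and> region t \<subseteq> region q" if "k\<^sub>0 \<le> k" for k
    using that
  proof (induction k rule: dec_induct)
    case base
    then show ?case using q by blast
  next
    case (step k)
    then obtain t where "descendant k t" "region t \<subseteq> region q" by blast
    then show ?case
      using fifth_daughter_descendant region_daughter_subset[OF descendant_is_tile]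
      by (metis order_trans)
  qed
  have lat: "v \<in> lattice k" if "descendant k t" "descendant k (map_tile (\<lambda>z. z + v) t)" for k t
  proof -
    obtain A d s where t: "t = tile_at A d s" "on_grid k A d"
      using descendant_on_grid[OF \<open>descendant k t\<close>] by blast
    have "A + v \<in> lattice k"
      using \<open>descendant k (map_tile _ t)\<close> on_gridD(1)[OF descendant_tile_at_on_grid]
      unfolding t(1) map_tile_translate_tile_at by blast
    then show ?thesis
      using lattice_add_right_iff[OF on_gridD(1)[OF t(2)], of v] by (simp add: add.commute)
  qed
  \<comment> \<open>Downward induction from \<open>N\<close> to the level of \<open>q\<close>. Only
    tiles inside \<open>q\<close> are tracked, since \<open>inv\<close> speaks only of these, and
    translates keep their level.\<close>
  have "v \<in> lattice k \<and> (\<forall>t m. t \<in> subdivision root_tile k \<longrightarrow> region t \<subseteq> region q \<longrightarrow>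
      descendant m t \<longrightarrow> descendant m (map_tile (\<lambda>z. z + v) t))"
    if "k \<le> N" "k\<^sub>0 \<le> k" for k
    using that
  proof (induction k rule: inc_induct)
    case base
    have *: "descendant m (map_tile (\<lambda>z. z + v) t)"
      if t: "t \<in> subdivision root_tile N" "region t \<subseteq> region q" "descendant m t" for t m
    proof -
      obtain k where k: "descendant k (map_tile (\<lambda>z. z + v) t)"
        using inv[OF t(1,2)] by (elim subdivision_root_level)
      have "hypotenuse (map_tile (\<lambda>z. z + v) t) = hypotenuse t"
        by (cases t) simp
      then show ?thesis using descendant_level_unique k t(3) by metis
    qed
    moreover obtain t where "descendant N t" "region t \<subseteq> region q" using ex base by blast
    ultimately show ?case
      using lat descendant_in_subdivision_root by blast
  next
    case (step k)
    then have IH: "v \<in> lattice (Suc k)"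
      "\<And>t m. t \<in> subdivision root_tile (Suc k) \<Longrightarrow> region t \<subseteq> region q \<Longrightarrow>
        descendant m t \<Longrightarrow> descendant m (map_tile (\<lambda>z. z + v) t)"
      by auto
    have *: "descendant m (map_tile (\<lambda>z. z + v) t)"
      if t: "t \<in> subdivision root_tile k" "region t \<subseteq> region q" "descendant m t" for t m
    \<comment> \<open>Tiles of higher level survive to stage \<open>Suc k\<close>; only a tile of
      level exactly \<open>k\<close> must be rebuilt from its first daughter.\<close>
    proof (cases "m = k")
      case False
      then have "\<not> descendant k t" using descendant_level_unique t(3) by metis
      then have "t \<in> subdivision root_tile (Suc k)"
        unfolding subdivision_root_Suc using t(1) by auto
      then show ?thesis using IH(2) t by blast
    next
      case True
      obtain A d s where m: "t = tile_at A d s" "on_grid m A d"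
        using descendant_on_grid[OF t(3)] by blast
      define u where "u = tile_at A (d * apex s / 2) (\<not> s)"
      have u: "u \<in> daughters t"
        using on_gridD(4)[OF m(2)] by (simp add: m(1) u_def daughters_tile_at)
      have "descendant (k + 3) u" using t(3) descendant.d1 by (simp add: u_def m(1) True)
      moreover have "u \<in> subdivision root_tile (Suc k)"
        using daughters_subdivision_root t u True by blast
      moreover have "region u \<subseteq> region q"
        using region_daughter_subset[OF descendant_is_tile[OF t(3)] u] t(2) by blast
      ultimately have "descendant (k + 3) (map_tile (\<lambda>z. z + v) u)"
        using IH(2) by blast
      then have "descendant k (tile_at (A + v) d s)"
        using translated_first_daughter(2)[of k A d s v] t(3) IH(1)
        by (simp add: True m(1) u_def map_tile_translate_tile_at)
      then show ?thesis by (simp add: m(1) True map_tile_translate_tile_at)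
    qed
    moreover obtain t where "descendant k t" "region t \<subseteq> region q" using ex step by blast
    ultimately show ?case
      using lat descendant_in_subdivision_root by blast
  qed
  then show ?thesis using \<open>k\<^sub>0 \<le> N\<close> by blast
qed

section \<open>A descendant with room around it inside the root tile\<close>

lemma region_root_superset: "{z. 0 < Im z \<and> Im z < Re z \<and> Im z < 1 - Re z} \<subseteq> region root_tile"
proof clarify
  fix z assume z: "0 < Im z" "Im z < Re z" "Im z < 1 - Re z"
  \<comment> \<open>Barycentric coordinates with respect to 0, the apex and 1.\<close>
  have "z = (1 - Re z - Im z) *\<^sub>R 0 + (2 * Im z) *\<^sub>R (1 * apex True) + (Re z - Im z) *\<^sub>R 1"
    by (simp add: apex_def complex_eq_iff)
  then show "z \<in> region root_tile"
    using z unfolding tile_at_def region.simps convex_hull_3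
    by (intro CollectI exI[of _ "1 - Re z - Im z"] exI[of _ "2 * Im z"] exI[of _ "Re z - Im z"])
      simp
qed

text \<open>A compact tile in the open triangle has positive distance to the complement. Short
  translates of tiles inside \<open>q\<close> then never leave the root tile.\<close>

lemma interior_descendant:
  obtains q \<delta> where "descendant 6 q" "\<delta> > 0"
    "\<And>x v. x \<in> region q \<Longrightarrow> norm v < \<delta> \<Longrightarrow> x + v \<in> region root_tile"
proof -
  define U where "U = {z. 0 < Im z \<and> Im z < Re z \<and> Im z < 1 - Re z}"
  \<comment> \<open>The second daughter of the third daughter of the root, hence of level 3 +
    3.\<close>
  define q where "q = tile_at (Complex (3/8) (1/4)) (1/8) False"
  have "tile_at (0 + 1 * apex True / 2 + 1 * apex (\<not> True) / 2 * apex True / 2)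
      (1 * apex (\<not> True) / 2 * apex True / 2) (\<not> True) = q"
    by (simp add: q_def tile_at_inject apex_def complex_eq_iff)
  then have "descendant 6 q"
    using descendant.d2[OF descendant.d3[OF descendant.root]] by simp
  moreover
  have "open U"
    unfolding U_def by (intro open_Collect_conj open_Collect_less continuous_intros)
  have "U = {z. \<i> \<bullet> z > 0} \<inter> {z. Complex 1 (-1) \<bullet> z > 0} \<inter> {z. Complex (-1) (-1) \<bullet> z > -1}"
    by (auto simp: U_def inner_complex_def)
  then have "convex U"
    by (simp only: convex_Int convex_halfspace_gt)
  then have "region q \<subseteq> U"
    unfolding q_def tile_at_def region.simps by (intro hull_minimal) (auto simp: U_def apex_def)
  moreover have "compact (region q)"
    by (simp add: q_def tile_at_def compact_convex_hull finite_imp_compact)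
  ultimately obtain \<delta> where "\<delta> > 0" "(\<Union>x\<in>region q. ball x \<delta>) \<subseteq> U"
    using compact_subset_open_imp_ball_epsilon_subset[of "region q" U] \<open>open U\<close> by blast
  then have "x + v \<in> region root_tile" if "x \<in> region q" "norm v < \<delta>" for x v
    using that region_root_superset unfolding U_def[symmetric]
    by (metis UN_I add_diff_cancel_left' dist_commute dist_norm mem_ball subsetD)
  then show thesis using that \<open>descendant 6 q\<close> \<open>\<delta> > 0\<close> by blast
qed

subsection \<open>Similarities\<close>

definition similarity :: "real \<Rightarrow> (complex \<Rightarrow> complex) \<Rightarrow> bool" where
  "similarity r g \<longleftrightarrow> r > 0 \<and> (\<forall>x y. dist (g x) (g y) = r * dist x y)"

lemma similarity_comp: "similarity r g \<Longrightarrow> similarity s h \<Longrightarrow> similarity (r * s) (g \<circ> h)"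
  by (simp add: similarity_def)

lemma similarity_affine: "p \<noteq> 0 \<Longrightarrow> similarity (norm p) (\<lambda>z. p * z + q)"
  and similarity_affine_cnj: "p \<noteq> 0 \<Longrightarrow> similarity (norm p) (\<lambda>z. p * cnj z + q)"
proof -
  have "norm (p * cnj x - p * cnj y) = norm p * norm (x - y)" for x y
    by (metis complex_cnj_diff complex_mod_cnj norm_mult right_diff_distrib)
  then show "p \<noteq> 0 \<Longrightarrow> similarity (norm p) (\<lambda>z. p * cnj z + q)"
    by (simp add: similarity_def dist_norm)
  show "p \<noteq> 0 \<Longrightarrow> similarity (norm p) (\<lambda>z. p * z + q)"
    by (simp add: similarity_def dist_norm right_diff_distrib[symmetric] norm_mult)
qed

text \<open>Circles centred at 0 and 1 meet in points symmetric about the real axis.\<close>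

lemma complex_eq_or_cnj:
  assumes "norm w = norm z" "norm (w - 1) = norm (z - 1)"
  shows "w = z \<or> w = cnj z"
proof -
  have 1: "(Re w)\<^sup>2 + (Im w)\<^sup>2 = (Re z)\<^sup>2 + (Im z)\<^sup>2"
    using assms(1) by (metis cmod_power2)
  have "(Re w - 1)\<^sup>2 + (Im w)\<^sup>2 = (Re z - 1)\<^sup>2 + (Im z)\<^sup>2"
    using arg_cong[OF assms(2), of "\<lambda>x. x\<^sup>2"] by (simp add: cmod_power2)
  with 1 have "Re w = Re z" by (simp add: power2_diff)
  moreover from this 1 have "Im w = Im z \<or> Im w = - Im z"
    by (simp add: power2_eq_iff)
  ultimately show ?thesis by (auto simp: complex_eq_iff)
qed

text \<open>Normalise to \<open>w\<close>, an isometry fixing 0 and 1, which sends each point to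
  itself or its conjugate. The image of \<open>\<i>\<close> decides for all points: a non-real point
  choosing otherwise would change its distance to \<open>\<i>\<close>.\<close>

lemma similarity_cases:
  assumes "similarity r g"
  obtains (direct) p q where "norm p = r" "p \<noteq> 0" "g = (\<lambda>z. p * z + q)"
  | (reversing) p q where "norm p = r" "p \<noteq> 0" "g = (\<lambda>z. p * cnj z + q)"
proof -
  have r: "r > 0" and g: "\<And>x y. dist (g x) (g y) = r * dist x y"
    using assms by (auto simp: similarity_def)
  define q where "q = g 0"
  define p where "p = g 1 - g 0"
  define w where "w z = (g z - q) / p" for z
  have p: "norm p = r"
    using g[of 1 0] by (simp add: p_def dist_norm)
  then have p0: "p \<noteq> 0" using r by auto
  have gw: "g z = p * w z + q" for z
    using p0 by (simp add: w_def)
  have w: "norm (w x - w y) = norm (x - y)" for x y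
  proof -
    have "w x - w y = (g x - g y) / p"
      by (simp add: w_def diff_divide_distrib)
    then show ?thesis
      using g[of x y] p r by (simp add: norm_divide dist_norm)
  qed
  have w0: "w 0 = 0" "w 1 = 1" using p0 by (auto simp: w_def q_def p_def)
  have wz: "w z = z \<or> w z = cnj z" for z
    using complex_eq_or_cnj[of "w z" z] w[of z 0] w[of z 1] by (simp add: w0)
  consider "w \<i> = \<i>" | "w \<i> = - \<i>" using wz[of \<i>] by auto
  then show thesis
  proof cases
    case 1
    have "w z = z" for z
    proof (rule ccontr)
      assume n: "w z \<noteq> z"
      then have e: "w z = cnj z" using wz by blast
      have "(norm (cnj z - \<i>))\<^sup>2 = (norm (z - \<i>))\<^sup>2"
        using w[of z \<i>] by (simp add: 1 e)
      then have "Im z = 0"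
        unfolding cmod_power2 by (simp add: power2_eq_square algebra_simps)
      then show False using n e by (simp add: complex_eq_iff)
    qed
    then show thesis using direct[OF p p0] gw by auto
  next
    case 2
    have "w z = cnj z" for z
    proof (rule ccontr)
      assume n: "w z \<noteq> cnj z"
      then have e: "w z = z" using wz by blast
      have "(norm (z + \<i>))\<^sup>2 = (norm (z - \<i>))\<^sup>2"
        using w[of z \<i>] by (simp add: 2 e)
      then have "Im z = 0"
        unfolding cmod_power2 by (simp add: power2_eq_square algebra_simps)
      then show False using n e by (simp add: complex_eq_iff)
    qed
    then show thesis using reversing[OF p p0] gw by auto
  qed
qed

lemma similarity_inverse:
  assumes "similarity r g"
  obtains h where "similarity (1 / r) h" "\<And>x. g (h x) = x" "\<And>x. h (g x) = x"
  using assms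
proof (cases rule: similarity_cases)
  case (direct p q)
  have n: "norm (inverse p) = 1 / r"
    using direct(1) by (simp only: inverse_eq_divide norm_divide norm_one)
  have "inverse p \<noteq> 0" using direct(2) by simp
  then have "similarity (1 / r) (\<lambda>w. inverse p * w + (- q / p))"
    using similarity_affine[of "inverse p" "- q / p"] unfolding n by blast
  moreover have "g (inverse p * x + - q / p) = x" "inverse p * g x + - q / p = x" for x
    using direct(2) by (simp_all add: direct(3) distrib_left right_diff_distrib mult.assoc[symmetric] inverse_eq_divide)
  ultimately show thesis by (rule that)
next
  case (reversing p q)
  have n: "norm (inverse (cnj p)) = 1 / r"
    using reversing(1) by (simp only: inverse_eq_divide norm_divide norm_one complex_mod_cnj)
  have "inverse (cnj p) \<noteq> 0" using reversing(2) by simp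
  then have "similarity (1 / r) (\<lambda>w. inverse (cnj p) * cnj w + (- cnj (q / p)))"
    using similarity_affine_cnj[of "inverse (cnj p)" "- cnj (q / p)"] unfolding n by blast
  moreover have "g (inverse (cnj p) * cnj x + - cnj (q / p)) = x"
    "inverse (cnj p) * cnj (g x) + - cnj (q / p) = x" for x
    using reversing(2) by (simp_all add: reversing(3) distrib_left right_diff_distrib mult.assoc[symmetric] inverse_eq_divide)
  ultimately show thesis by (rule that)
qed

text \<open>Pulls a period of the tiling back to root coordinates, where it becomes short if
  \<open>r\<close> is large.\<close>

lemma similarity_translation:
  assumes "similarity r g"
  obtains v' where "norm v' = norm v / r" "\<And>z. g z + v = g (z + v')"
  using assms
proof (cases rule: similarity_cases)
  case (direct p q)
  then show thesis
    by (intro that[of "v / p"]) (auto simp: norm_divide distrib_left)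
next
  case (reversing p q)
  then show thesis
    by (intro that[of "cnj (v / p)"]) (auto simp: norm_divide distrib_left)
qed

lemma map_tile_comp: "map_tile f (map_tile g t) = map_tile (f \<circ> g) t"
  by (cases t) simp

lemma map_tile_inverse: "(\<And>x. f (g x) = x) \<Longrightarrow> map_tile f (map_tile g t) = t"
  by (cases t) simp

lemma similarity_inj_map_tile: "similarity r g \<Longrightarrow> inj (map_tile g)"
  by (metis injI map_tile_inverse similarity_inverse)

lemma hypotenuse_similarity: "similarity r g \<Longrightarrow> hypotenuse (map_tile g t) = r * hypotenuse t"
  by (cases t) (simp add: similarity_def)

lemma is_tile_similarity:
  assumes "similarity r g" "is_tile t"
  shows "is_tile (map_tile g t)"
proof -
  obtain A d s where t: "t = tile_at A d s" "d \<noteq> 0"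
    using assms(2) is_tile_iff_tile_at by blast
  from assms(1) show ?thesis
  proof (cases rule: similarity_cases)
    case (direct p q)
    then have "map_tile g t = tile_at (p * A + q) (p * d) s"
      by (simp add: t tile_at_def algebra_simps)
    then show ?thesis using direct t is_tile_iff_tile_at by (metis mult_eq_0_iff)
  next
    case (reversing p q)
    then have "map_tile g t = tile_at (p * cnj A + q) (p * cnj d) (\<not> s)"
      by (simp add: t tile_at_def cnj_apex[symmetric] algebra_simps)
    then show ?thesis
      using reversing t is_tile_iff_tile_at by (metis mult_eq_0_iff complex_cnj_zero_iff)
  qed
qed

lemma is_tile_from_root:
  assumes "is_tile t"
  obtains r g where "similarity r g" "t = map_tile g root_tile"
proof -
  obtain A d s where t: "t = tile_at A d s" "d \<noteq> 0"
    using assms is_tile_iff_tile_at by blast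
  show thesis
  proof (cases s)
    case True
    then have "t = map_tile (\<lambda>z. d * z + A) root_tile"
      by (simp add: t tile_at_def algebra_simps)
    then show thesis using that similarity_affine t(2) by blast
  next
    case False
    then have "t = map_tile (\<lambda>z. d * cnj z + A) root_tile"
      by (simp add: t tile_at_def cnj_apex algebra_simps)
    then show thesis using that similarity_affine_cnj t(2) by blast
  qed
qed

lemma similarity_midpoint: "similarity r g \<Longrightarrow> g (midpoint x y) = midpoint (g x) (g y)"
  by (erule similarity_cases) (auto simp: midpoint_def scaleR_conv_of_real distrib_left)

lemma daughters_similarity:
  assumes "similarity r g" "is_tile t"
  shows "daughters (map_tile g t) = map_tile g ` daughters t"
proof -
  obtain A C B where t: "t = (A, C, B)" by (cases t)
  have "is_tile (g A, g C, g B)"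
    using is_tile_similarity[OF assms] by (simp only: t map_tile.simps)
  then show ?thesis
    using assms(2) unfolding t map_tile.simps
    by (simp only: daughters_midpoint Let_def image_insert image_empty map_tile.simps
        similarity_midpoint[OF assms(1)])
qed

text \<open>All hypotenuses are multiplied by the same positive \<open>r\<close>, so the same tiles
  are largest.\<close>

lemma subdivide_largest_similarity:
  assumes "similarity r g" "\<forall>t\<in>S. is_tile t"
  shows "subdivide_largest (map_tile g ` S) = map_tile g ` subdivide_largest S"
proof -
  have "(if \<forall>u\<in>map_tile g ` S. hypotenuse u \<le> hypotenuse (map_tile g t)
        then daughters (map_tile g t) else {map_tile g t}) =
      map_tile g ` (if \<forall>u\<in>S. hypotenuse u \<le> hypotenuse t then daughters t else {t})"
    if "t \<in> S" for t
  proof -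
    have "r > 0" using assms(1) by (simp add: similarity_def)
    then show ?thesis
      using assms that by (simp add: hypotenuse_similarity[OF assms(1)] daughters_similarity)
  qed
  then show ?thesis
    unfolding subdivide_largest_def image_UN image_image by (intro SUP_cong refl)
qed

lemma subdivision_similarity:
  assumes "similarity r g"
  shows "subdivision (map_tile g root_tile) n = map_tile g ` subdivision root_tile n"
proof (induction n)
  case 0
  then show ?case by (simp add: subdivision_0)
next
  case (Suc n)
  have "\<forall>t\<in>subdivision root_tile n. is_tile t"
    using subdivision_root_level descendant_is_tile by metis
  then show ?case
    by (simp add: subdivision_Suc Suc subdivide_largest_similarity[OF assms])
qed

text \<open>The position and size of \<open>T\<close> are absorbed into the similarity, so all
  supertiles are images of subdivisions of one concrete tile.\<close>

lemma supertile_from_root: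
  assumes "is_tile T" "supertile T n S"
  obtains r g where "similarity r g" "S = map_tile g ` subdivision root_tile n"
proof -
  obtain e s where e: "euclidean_motion e" "rescaling s" "S = map_tile (e \<circ> s) ` subdivision T n"
    using assms(2) by (auto simp: supertile_def)
  obtain r g where g: "similarity r g" "T = map_tile g root_tile"
    using is_tile_from_root[OF assms(1)] .
  obtain c where c: "c > 0" "s = (\<lambda>z. c *\<^sub>R z)" using e(2) by (auto simp: rescaling_def)
  have "similarity 1 e" using e(1) by (simp add: similarity_def euclidean_motion_def)
  moreover have "similarity c s"
    using c by (simp add: similarity_def dist_norm scaleR_diff_right[symmetric])
  ultimately have "similarity (1 * c * r) (e \<circ> s \<circ> g)"
    using g(1) by (intro similarity_comp)
  moreover have "S = map_tile (e \<circ> s \<circ> g) ` subdivision root_tile n"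
    by (simp add: e(3) g(2) subdivision_similarity[OF g(1)] image_image map_tile_comp comp_assoc)
  ultimately show thesis by (rule that)
qed

section \<open>Regions under similarities and in tilings\<close>

lemma region_similarity:
  assumes "similarity r g"
  shows "region (map_tile g t) = g ` region t"
proof -
  have "convex hull (g ` S) = g ` (convex hull S)" for S
    using assms
  proof (cases rule: similarity_cases)
    case (direct p q)
    have "linear ((*) p)" by (simp add: linear_iff algebra_simps)
    moreover have "g = (+) q \<circ> (*) p" using direct by (auto simp: add.commute)
    ultimately show ?thesis
      by (simp only: image_comp[symmetric] convex_hull_translation convex_hull_linear_image)
  next
    case (reversing p q)
    have "linear (\<lambda>z. p * cnj z)" by (simp add: linear_iff algebra_simps)
    moreover have "g = (+) q \<circ> (\<lambda>z. p * cnj z)" using reversing by (auto simp: add.commute)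
    ultimately show ?thesis
      by (simp only: image_comp[symmetric] convex_hull_translation convex_hull_linear_image)
  qed
  from this[of "{fst t, fst (snd t), snd (snd t)}"] show ?thesis by (cases t) simp
qed

lemma similarity_continuous: "similarity r g \<Longrightarrow> continuous_on UNIV g"
  by (erule similarity_cases) (auto intro!: continuous_intros)

lemma interior_region_nonempty:
  assumes "is_tile t"
  shows "interior (region t) \<noteq> {}"
proof -
  obtain r g where g: "similarity r g" "t = map_tile g root_tile"
    using is_tile_from_root[OF assms] .
  obtain h where h: "similarity (1 / r) h" "\<And>x. g (h x) = x" "\<And>x. h (g x) = x"
    using similarity_inverse[OF g(1)] by blast
  define U where "U = {z. 0 < Im z \<and> Im z < Re z \<and> Im z < 1 - Re z}"
  have "open U"
    unfolding U_def by (intro open_Collect_conj open_Collect_less continuous_intros)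
  then have "open (h -` U)"
    using similarity_continuous[OF h(1)] by (simp add: open_vimage)
  moreover have "h -` U \<subseteq> region t"
  proof
    fix x assume "x \<in> h -` U"
    then have "h x \<in> region root_tile" using region_root_superset by (auto simp: U_def)
    then show "x \<in> region t"
      unfolding g(2) region_similarity[OF g(1)] using h(2) by (metis image_eqI)
  qed
  ultimately have "h -` U \<subseteq> interior (region t)" by (simp add: interior_maximal)
  moreover have "g (Complex (1/2) (1/4)) \<in> h -` U"
    by (simp add: h(3) U_def)
  ultimately show ?thesis by blast
qed

lemma closure_interior_region:
  assumes "is_tile t"
  shows "closure (interior (region t)) = region t"
proof -
  have "convex (region t)" "compact (region t)"
    by (cases t; simp add: compact_convex_hull finite_imp_compact)+
  then show ?thesis
    using convex_closure_interior interior_region_nonempty[OF assms] compact_imp_closed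
    by (metis closure_closed)
qed

text \<open>An interior point of \<open>y\<close> lies in some \<open>region u\<close> with
  \<open>u \<in> S\<close>. That region is the closure of its interior, so the interiors of
  \<open>y\<close> and \<open>u\<close> meet, and \<open>y = u\<close>.\<close>

lemma tiling_covered_imp_mem:
  assumes X: "tiling_of_plane X" and "S \<subseteq> X" "y \<in> X" "region y \<subseteq> (\<Union>u\<in>S. region u)"
  shows "y \<in> S"
proof -
  have tiles: "is_tile t" if "t \<in> X" for t using X that by (simp add: tiling_of_plane_def)
  obtain x where x: "x \<in> interior (region y)"
    using interior_region_nonempty tiles \<open>y \<in> X\<close> by blast
  then obtain u where u: "u \<in> S" "x \<in> region u"
    using assms(4) interior_subset by blast
  then have "x \<in> closure (interior (region u))"
    using closure_interior_region tiles \<open>S \<subseteq> X\<close> by blast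
  then have "interior (region y) \<inter> interior (region u) \<noteq> {}"
    using x open_interior open_Int_closure_eq_empty by blast
  moreover have "u \<in> X" using u \<open>S \<subseteq> X\<close> by blast
  ultimately have "y = u" using X \<open>y \<in> X\<close> by (metis tiling_of_plane_def)
  then show ?thesis using u by simp
qed

subsection \<open>Nested supertiles, periods and meeting pairs\<close>

text \<open>A first daughter created at the last cut has level \<open>(n - 1) + 3\<close>; at stage
  0 nothing has been cut.\<close>

lemma subdivision_root_smallest:
  assumes "n \<ge> 1"
  obtains t where "t \<in> subdivision root_tile n" "descendant (n + 2) t"
proof -
  obtain m where n: "n = Suc m" using assms by (cases n) auto
  obtain t where t: "t \<in> subdivision root_tile m" "descendant m t"
    using subdivision_root_levels by blast
  obtain A d s where m: "t = tile_at A d s" "on_grid m A d"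
    using descendant_on_grid[OF t(2)] by blast
  have "tile_at A (d * apex s / 2) (\<not> s) \<in> daughters t"
    using on_gridD(4)[OF m(2)] by (simp add: m(1) daughters_tile_at)
  then have "tile_at A (d * apex s / 2) (\<not> s) \<in> subdivision root_tile n"
    using daughters_subdivision_root t n by blast
  moreover have "descendant (n + 2) (tile_at A (d * apex s / 2) (\<not> s))"
    using descendant.d1[of m A d s] t(2) by (simp add: m(1) n numeral_3_eq_3)
  ultimately show thesis by (rule that)
qed

lemma nested_supertiles_scale:
  assumes sim: "\<And>i. similarity (r i) (g i)"
    and S: "\<And>i. S i = map_tile (g i) ` subdivision root_tile (N i)"
    and N: "strict_mono N" and sub: "\<And>i. S i \<subseteq> S (Suc i)"
  obtains c where "c > 0" "\<And>i. i \<ge> 1 \<Longrightarrow> r i = c * sqrt 2 ^ N i"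
proof -
  \<comment> \<open>The largest hypotenuse occurring in \<open>S i\<close>.\<close>
  define c where "c i = r i * (1 / sqrt 2) ^ N i" for i
  have rpos: "r i > 0" for i using sim[of i] by (simp add: similarity_def)
  have le: "hypotenuse u \<le> c i" and ge: "c i / 2 \<le> hypotenuse u" if "u \<in> S i" for i u
  proof -
    obtain t where t: "t \<in> subdivision root_tile (N i)" "u = map_tile (g i) t"
      using \<open>u \<in> S i\<close> unfolding S by blast
    obtain k where k: "N i \<le> k" "k \<le> N i + 2" "descendant k t"
      using subdivision_root_level[OF t(1)] .
    have h: "hypotenuse u = r i * (1 / sqrt 2) ^ k"
      by (simp add: t(2) hypotenuse_similarity[OF sim] descendant_hypotenuse[OF k(3)])
    have "(1 / sqrt 2) ^ k \<le> (1 / sqrt 2) ^ N i" "(1 / sqrt 2) ^ (N i + 2) \<le> (1 / sqrt 2) ^ k"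
      using k by (simp_all only: power_inv_sqrt2_le_iff)
    moreover have "(1 / sqrt 2) ^ (N i + 2) = (1 / sqrt 2) ^ N i / 2"
      by (simp add: power_add power_divide)
    ultimately show "hypotenuse u \<le> c i" "c i / 2 \<le> hypotenuse u"
      using rpos[of i] unfolding h c_def by (simp_all add: mult_left_mono)
  qed
  \<comment> \<open>The smallest tiles of \<open>S i\<close>, with hypotenuse
    \<open>c i / 2\<close>, bound \<open>c (Suc i)\<close> from above, and the largest ones bound it
    from below. For \<open>i = 0\<close> the supertile may be a single tile, without the smaller
    size.\<close>
  have step: "c (Suc i) = c i" if "i \<ge> 1" for i
  proof (rule antisym)
    have "N i \<ge> 1" using strict_mono_imp_increasing[OF N, of i] that by linarith
    then obtain t where t: "t \<in> subdivision root_tile (N i)" "descendant (N i + 2) t"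
      using subdivision_root_smallest by blast
    have "map_tile (g i) t \<in> S (Suc i)" using t sub[of i] by (auto simp: S)
    then have "c (Suc i) / 2 \<le> hypotenuse (map_tile (g i) t)" by (rule ge)
    also have "\<dots> = r i * (1 / sqrt 2) ^ (N i + 2)"
      by (simp only: hypotenuse_similarity[OF sim] descendant_hypotenuse[OF t(2)])
    also have "\<dots> = c i / 2" by (simp add: c_def power_add power_divide)
    finally show "c (Suc i) \<le> c i" by simp
  next
    obtain t where t: "t \<in> subdivision root_tile (N i)" "descendant (N i) t"
      using subdivision_root_levels by blast
    have "c i = hypotenuse (map_tile (g i) t)"
      by (simp only: c_def hypotenuse_similarity[OF sim] descendant_hypotenuse[OF t(2)])
    also have "\<dots> \<le> c (Suc i)"
      using t sub[of i] by (intro le) (auto simp: S)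
    finally show "c i \<le> c (Suc i)" .
  qed
  have const: "c i = c 1" if "i \<ge> 1" for i
    using that by (induction i rule: dec_induct) (simp_all add: step)
  have "r i = c i * sqrt 2 ^ N i" for i
    by (simp add: c_def power_divide)
  then have "r i = c 1 * sqrt 2 ^ N i" if "i \<ge> 1" for i
    using const[OF that] by metis
  moreover have "c 1 > 0" using rpos by (simp add: c_def)
  ultimately show thesis using that by blast
qed

lemma tiling_with_large_supertiles_no_period:
  assumes X: "tiling_of_plane X"
    and sim: "\<And>i. similarity (r i) (g i)" and r: "\<And>b. \<exists>i. N i \<ge> 6 \<and> r i > b"
    and sub: "\<And>i. map_tile (g i) ` subdivision root_tile (N i) \<subseteq> X"
    and per: "map_tile (\<lambda>z. z + v) ` X = X"
  shows "v = 0"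
proof -
  obtain q \<delta> where q: "descendant 6 q" "\<delta> > 0"
    "\<And>x v. x \<in> region q \<Longrightarrow> norm v < \<delta> \<Longrightarrow> x + v \<in> region root_tile"
    using interior_descendant by blast
  \<comment> \<open>The two bounds make the pulled-back period shorter than \<open>\<delta>\<close>
    and than 1/8, where \<open>8 = sqrt 2 ^ 6\<close> belongs to the level of \<open>q\<close>;
    \<open>N i \<ge> 6\<close> lets the descent reach \<open>q\<close>.\<close>
  obtain i where i: "N i \<ge> 6" "r i > max (norm v / \<delta>) (norm v * 8)" using r by blast
  have rpos: "r i > 0" using sim[of i] by (simp add: similarity_def)
  obtain v' where v': "norm v' = norm v / r i" "\<And>z. g i z + v = g i (z + v')"
    using similarity_translation[OF sim[of i]] by blast
  have small: "norm v' < \<delta>" "norm v' * 8 < 1"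
    using i(2) rpos q(2) by (simp_all add: v'(1) field_simps)
  have "v' \<in> lattice 6"
  proof (rule translation_descent[OF q(1) i(1)])
    fix t assume t: "t \<in> subdivision root_tile (N i)" "region t \<subseteq> region q"
    \<comment> \<open>\<open>y\<close> is the translate by the period of a tile of \<open>X\<close>,
      hence in \<open>X\<close>; it lies over the supertile and so belongs to it.\<close>
    define y where "y = map_tile (g i) (map_tile (\<lambda>z. z + v') t)"
    have "y = map_tile (\<lambda>z. z + v) (map_tile (g i) t)"
      by (simp add: y_def map_tile_comp comp_def v'(2))
    then have "y \<in> X"
      using per sub t(1) by blast
    have "similarity 1 (\<lambda>z. z + v')" by (simp add: similarity_def)
    then have "region (map_tile (\<lambda>z. z + v') t) = (\<lambda>z. z + v') ` region t"
      by (rule region_similarity)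
    then have "region (map_tile (\<lambda>z. z + v') t) \<subseteq> region root_tile"
      using q(3) t(2) small(1) by auto
    then have "region (map_tile (\<lambda>z. z + v') t) \<subseteq> (\<Union>u\<in>subdivision root_tile (N i). region u)"
      using region_root_covered[of "N i"] by (rule order_trans)
    then have "region y \<subseteq> (\<Union>u\<in>map_tile (g i) ` subdivision root_tile (N i). region u)"
      unfolding y_def image_image region_similarity[OF sim] by blast
    then have "y \<in> map_tile (g i) ` subdivision root_tile (N i)"
      using tiling_covered_imp_mem[OF X sub \<open>y \<in> X\<close>] by blast
    then show "map_tile (\<lambda>z. z + v') t \<in> subdivision root_tile (N i)"
      using similarity_inj_map_tile[OF sim[of i]] by (simp add: y_def inj_image_mem_iff)
  qed
  moreover have "sqrt 2 ^ 6 = 8"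
    using power_mult[of "sqrt 2" 2 3] by simp
  ultimately have "v' = 0"
    using small(2) lattice_small_eq_0 by metis
  then show ?thesis using v'(1) rpos by simp
qed

section \<open>Congruence classes of meeting pairs\<close>

lemma euclidean_motion_similarity: "euclidean_motion e \<longleftrightarrow> similarity 1 e"
  by (simp add: euclidean_motion_def similarity_def)

text \<open>Composing motions gives one inclusion; applied to the inverse of \<open>e\<close> it
  gives the other.\<close>

lemma congruence_class_eq:
  assumes "similarity 1 e"
  shows "congruence `` {map_tile e ` P} = congruence `` {P}"
proof -
  obtain h where h: "similarity 1 h" "\<And>x. e (h x) = x" "\<And>x. h (e x) = x"
    using similarity_inverse[OF assms] by auto
  have P: "P = map_tile h ` map_tile e ` P"
    using map_tile_inverse[of h e] h(3) by (simp add: image_image)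
  have "congruence `` {map_tile f ` Q} \<subseteq> congruence `` {Q}" if "similarity 1 f" for f Q
  proof
    fix R assume "R \<in> congruence `` {map_tile f ` Q}"
    then obtain f' where f': "similarity 1 f'" "R = map_tile f' ` map_tile f ` Q"
      by (auto simp: congruence_def euclidean_motion_similarity)
    then have "R = map_tile (f' \<circ> f) ` Q" by (simp add: image_image map_tile_comp)
    moreover have "similarity 1 (f' \<circ> f)" using similarity_comp[OF f'(1) that] by simp
    ultimately show "R \<in> congruence `` {Q}"
      by (auto simp: congruence_def euclidean_motion_similarity)
  qed
  from this[OF assms, of P] this[OF h(1), of "map_tile e ` P"] P show ?thesis by simp
qed

lemma finite_gauss_cball: "finite (gauss \<inter> cball 0 b)"
proof (rule finite_subset)
  let ?I = "{n :: int. \<bar>real_of_int n\<bar> \<le> b}"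
  have "?I \<subseteq> {- \<lceil>b\<rceil>..\<lceil>b\<rceil>}"
    by auto linarith+
  then show "finite ((\<lambda>(m, n). Complex (of_int m) (of_int n)) ` (?I \<times> ?I))"
    using finite_subset by blast
  show "gauss \<inter> cball 0 b \<subseteq> (\<lambda>(m, n). Complex (of_int m) (of_int n)) ` (?I \<times> ?I)"
  proof
    fix z assume z: "z \<in> gauss \<inter> cball 0 b"
    then obtain m n where "Re z = of_int m" "Im z = of_int n"
      by (auto simp: gauss_def elim!: Ints_cases)
    moreover from this have "\<bar>real_of_int m\<bar> \<le> b" "\<bar>real_of_int n\<bar> \<le> b"
      using z abs_Re_le_cmod[of z] abs_Im_le_cmod[of z] by auto
    ultimately show "z \<in> (\<lambda>(m, n). Complex (of_int m) (of_int n)) ` (?I \<times> ?I)"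
      by (intro image_eqI[of _ _ "(m, n)"]) (auto simp: complex_eq_iff)
  qed
qed

lemma region_tile_at_bound:
  assumes "x \<in> region (tile_at A d s)"
  shows "norm (x - A) \<le> norm d"
proof -
  have "norm (apex s) \<le> 1"
    by (rule order_trans[OF cmod_le]) (simp add: apex_def)
  then have "norm (d * apex s) \<le> norm d"
    by (simp add: norm_mult mult_left_le)
  then have "region (tile_at A d s) \<subseteq> cball A (norm d)"
    unfolding tile_at_def region.simps by (intro hull_minimal) (auto simp: dist_norm)
  then show ?thesis using assms by (auto simp: dist_norm norm_minus_commute)
qed

lemma meeting_imp_common_point:
  assumes "P \<in> meeting_pairs X"
  obtains t u x where "P = {t, u}" "t \<in> X" "u \<in> X" "x \<in> region t" "x \<in> region u"
proof -
  obtain t u p q where tu: "P = {t, u}" "t \<in> X" "u \<in> X"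
      "closed_segment p q \<subseteq> frontier (region t) \<inter> frontier (region u)"
    using assms by (auto simp: meeting_pairs_def)
  have "closed (region w)" for w
    by (cases w) (simp add: compact_imp_closed compact_convex_hull finite_imp_compact)
  then have "frontier (region w) \<subseteq> region w" for w
    by (rule frontier_subset_closed)
  moreover have "p \<in> frontier (region t)" "p \<in> frontier (region u)"
    using tu(4) ends_in_segment(1)[of p q] by blast+
  ultimately have "p \<in> region t" "p \<in> region u" by blast+
  then show thesis using that tu by blast
qed

text \<open>The tiles of the \<open>n\<close>-th subdivision, enlarged by \<open>(1 + \<i>) ^ (n + 2)\<close>, have Gaussian integer
  acute vertices and hypotenuse at most 2.\<close>

lemma meeting_tiles_normal_form:
  assumes g: "similarity r g" and tu: "t \<in> subdivision root_tile n" "u \<in> subdivision root_tile n"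
    and meet: "x \<in> region t" "x \<in> region u"
  obtains h t' u' where "similarity (r / sqrt 2 ^ (n + 2)) h"
    "map_tile g t = map_tile h t'" "map_tile g u = map_tile h u'"
    "{t', u'} \<subseteq> (\<lambda>(A, d, s). tile_at A d s) ` ((gauss \<inter> cball 0 4) \<times> (gauss \<inter> cball 0 4) \<times> UNIV)"
proof -
  \<comment> \<open>No level exceeds \<open>n + 2\<close>, so multiplication by \<open>w\<close>
    clears all denominators.\<close>
  define w where "w = (1 + \<i>) ^ (n + 2)"
  have w0: "w \<noteq> 0" by (simp add: w_def one_plus_i_neq_0)
  have nw: "norm w = sqrt 2 ^ (n + 2)"
    unfolding w_def norm_power by (simp add: cmod_def)
  have tile: "\<exists>A d s. y = tile_at A d s \<and> A * w \<in> gauss \<and> d * w \<in> gauss \<and> norm (d * w) \<le> 2"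
    if y: "y \<in> subdivision root_tile n" for y
  proof -
    obtain k where k: "n \<le> k" "k \<le> n + 2" "descendant k y" using subdivision_root_level[OF y] .
    obtain A d s where m: "y = tile_at A d s" "on_grid k A d" using descendant_on_grid[OF k(3)] by blast
    have "A \<in> lattice (n + 2)" "d \<in> lattice (n + 2)"
      using on_gridD(1,2)[OF m(2)] lattice_mono[OF k(2)] by blast+
    moreover have "norm d \<le> (1 / sqrt 2) ^ n"
      using on_gridD(3)[OF m(2)] k(1) power_inv_sqrt2_le_iff by simp
    then have "norm (d * w) \<le> (1 / sqrt 2) ^ n * sqrt 2 ^ (n + 2)"
      by (simp add: norm_mult nw mult_right_mono)
    moreover have "(1 / sqrt 2) ^ n * sqrt 2 ^ (n + 2) = 2"
      by (simp add: power_add power_divide)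
    ultimately show ?thesis using m(1) unfolding lattice_def w_def by auto
  qed
  obtain A d s where t: "t = tile_at A d s" "A * w \<in> gauss" "d * w \<in> gauss" "norm (d * w) \<le> 2"
    using tile[OF tu(1)] by blast
  obtain B e s' where u: "u = tile_at B e s'" "B * w \<in> gauss" "e * w \<in> gauss" "norm (e * w) \<le> 2"
    using tile[OF tu(2)] by blast
  \<comment> \<open>Undoes the enlargement and moves 0 back to \<open>A\<close>, so that the first
    tile starts at 0.\<close>
  define f where "f z = inverse w * z + A" for z
  \<comment> \<open>The common point \<open>x\<close> is within a hypotenuse of each start vertex;
    after enlargement this gives the bound 2 + 2 = 4.\<close>
  have "norm (B - A) \<le> norm d + norm e"
    using region_tile_at_bound[of x A d s] region_tile_at_bound[of x B e s'] meet t(1) u(1)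
      norm_triangle_ineq4[of "x - A" "x - B"] by simp
  then have "norm ((B - A) * w) \<le> (norm d + norm e) * norm w"
    by (simp add: norm_mult mult_right_mono)
  then have "norm ((B - A) * w) \<le> 4"
    using t(4) u(4) by (simp add: norm_mult distrib_right)
  moreover have "(B - A) * w \<in> gauss"
    using gauss_diff[OF u(2) t(2)] by (simp add: left_diff_distrib)
  ultimately have "(0, d * w, s) \<in> (gauss \<inter> cball 0 4) \<times> (gauss \<inter> cball 0 4) \<times> UNIV"
    "((B - A) * w, e * w, s') \<in> (gauss \<inter> cball 0 4) \<times> (gauss \<inter> cball 0 4) \<times> UNIV"
    using t u gauss_0 by auto
  then have in_set: "{tile_at 0 (d * w) s, tile_at ((B - A) * w) (e * w) s'} \<subseteq>
      (\<lambda>(A, d, s). tile_at A d s) ` ((gauss \<inter> cball 0 4) \<times> (gauss \<inter> cball 0 4) \<times> UNIV)"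
    by force
  have f: "similarity (norm (inverse w)) f"
    using similarity_affine[of "inverse w" A] w0 by (simp add: f_def[abs_def])
  have "r * norm (inverse w) = r / sqrt 2 ^ (n + 2)"
    by (simp only: norm_inverse nw divide_inverse)
  then have "similarity (r / sqrt 2 ^ (n + 2)) (g \<circ> f)"
    using similarity_comp[OF g f] by simp
  moreover have "t = map_tile f (tile_at 0 (d * w) s)" "u = map_tile f (tile_at ((B - A) * w) (e * w) s')"
    using w0 by (simp_all add: t(1) u(1) tile_at_def f_def field_simps)
  then have "map_tile g t = map_tile (g \<circ> f) (tile_at 0 (d * w) s)"
    "map_tile g u = map_tile (g \<circ> f) (tile_at ((B - A) * w) (e * w) s')"
    by (simp_all add: map_tile_comp)
  ultimately show thesis using in_set by (rule that)
qed

theorem theorem11: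
  fixes T :: tile and X :: "tile set"
  assumes "is_tile T"
    and "hierarchical_tiling T X"
  shows "\<not> periodic_tiling X \<and> finite (ways_of_meeting X)"
proof -
  obtain S N where X: "tiling_of_plane X" and N: "strict_mono N"
    and super: "\<And>i. supertile T (N i) (S i)" and sub: "\<And>i. S i \<subset> S (Suc i)"
    and union: "X = (\<Union>i. S i)"
    using assms(2) unfolding hierarchical_tiling_def by blast
  have "\<exists>r g. similarity r g \<and> S i = map_tile g ` subdivision root_tile (N i)" for i
    using supertile_from_root[OF assms(1) super] by metis
  then obtain r g where sim: "\<And>i. similarity (r i) (g i)"
    and S: "\<And>i. S i = map_tile (g i) ` subdivision root_tile (N i)"
    by metis
  obtain c where c: "c > 0" "\<And>i. i \<ge> 1 \<Longrightarrow> r i = c * sqrt 2 ^ N i"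
    using nested_supertiles_scale[OF sim S N] sub by blast
  have "v = 0" if "map_tile (\<lambda>z. z + v) ` X = X" for v
  proof (rule tiling_with_large_supertiles_no_period[OF X sim _ _ that])
    show "\<exists>i. 6 \<le> N i \<and> b < r i" for b
    proof -
      \<comment> \<open>The scales are unbounded because \<open>N i \<ge> i\<close>; the added 6
        secures the level of \<open>q\<close>.\<close>
      obtain m where m: "b / c < sqrt 2 ^ m" using real_arch_pow[of "sqrt 2" "b / c"] by auto
      define i where "i = m + 6"
      have i: "m + 6 \<le> N i" using strict_mono_imp_increasing[OF N] by (simp add: i_def)
      then have "sqrt 2 ^ m \<le> sqrt 2 ^ N i" by (intro power_increasing) auto
      then have "b / c < sqrt 2 ^ N i" using m by linarith
      then have "b < r i" using c by (simp add: i_def field_simps)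
      then show ?thesis using i by (intro exI[of _ i]) simp
    qed
    show "map_tile (g i) ` subdivision root_tile (N i) \<subseteq> X" for i
      using union S by blast
  qed
  then have "\<not> periodic_tiling X"
    unfolding periodic_tiling_def by (metis dependent_zero insertI1 )
  moreover have "finite (ways_of_meeting X)"
  proof -
    \<comment> \<open>Finitely many candidate tiles. Since \<open>r i / sqrt 2 ^ (N i + 2)\<close>
      equals \<open>c / 2\<close> for all \<open>i \<ge> 1\<close>, one map \<open>scale\<close>
      fits the whole tiling, and every class comes from a subset of \<open>Q\<close>.\<close>
    define Q where "Q = (\<lambda>(A, d, s). tile_at A d s) ` ((gauss \<inter> cball 0 4) \<times> (gauss \<inter> cball 0 4) \<times> UNIV)"
    have "finite Q" unfolding Q_def by (intro finite_imageI finite_cartesian_product finite_gauss_cball) simp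
    define scale where "scale z = (complex_of_real (c / 2)) * z" for z
    have scale: "similarity (c / 2) scale"
      using similarity_affine[of "complex_of_real (c / 2)" 0] c(1) by (simp add: scale_def[abs_def])
    obtain unscale where un: "similarity (1 / (c / 2)) unscale" "\<And>x. unscale (scale x) = x"
      using similarity_inverse[OF scale] by metis
    have "congruence `` {P} \<in> (\<lambda>R. congruence `` {map_tile scale ` R}) ` Pow Q"
      if "P \<in> meeting_pairs X" for P
    proof -
      obtain y z x where yz: "P = {y, z}" "y \<in> X" "z \<in> X" "x \<in> region y" "x \<in> region z"
        using meeting_imp_common_point[OF \<open>P \<in> meeting_pairs X\<close>] .
      obtain j k where "y \<in> S j" "z \<in> S k" using yz union by blast
      \<comment> \<open>The successor ensures \<open>i \<ge> 1\<close>, where the formula for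
        \<open>r i\<close> holds.\<close>
      moreover define i where "i = Suc (max j k)"
      moreover have "S a \<subseteq> S b" if "a \<le> b" for a b
        using lift_Suc_mono_le[of S] sub that by blast
      ultimately have "y \<in> S i" "z \<in> S i" by (meson le_SucI max.cobounded1 max.cobounded2 subsetD)+
      then obtain t u where tu: "t \<in> subdivision root_tile (N i)" "u \<in> subdivision root_tile (N i)"
        "y = map_tile (g i) t" "z = map_tile (g i) u"
        unfolding S by blast
      obtain h where h: "\<And>x. h (g i x) = x" using similarity_inverse[OF sim] by metis
      have "h x \<in> region t" "h x \<in> region u"
        using yz(4,5) h unfolding tu(3,4) region_similarity[OF sim] by (metis imageE)+
      then obtain f t' u' where f: "similarity (r i / sqrt 2 ^ (N i + 2)) f"
        "map_tile (g i) t = map_tile f t'" "map_tile (g i) u = map_tile f u'" "{t', u'} \<subseteq> Q"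
        using meeting_tiles_normal_form[OF sim tu(1,2)] unfolding Q_def by metis
      have "r i / sqrt 2 ^ (N i + 2) = c / 2"
        using c(2)[of i] by (simp add: i_def power_add)
      \<comment> \<open>The factors \<open>c / 2\<close> of \<open>f\<close> and
        \<open>scale\<close> cancel, leaving a Euclidean motion.\<close>
      then have e: "similarity 1 (f \<circ> unscale)"
        using similarity_comp[OF f(1) un(1)] c(1) by simp
      have "P = map_tile (f \<circ> unscale) ` map_tile scale ` {t', u'}"
        by (simp add: yz(1) tu(3,4) f(2,3) map_tile_comp comp_def un(2))
      then have "congruence `` {P} = congruence `` {map_tile scale ` {t', u'}}"
        using congruence_class_eq[OF e] by metis
      then show ?thesis using f(4) by blast
    qed
    then have "ways_of_meeting X \<subseteq> (\<lambda>R. congruence `` {map_tile scale ` R}) ` Pow Q"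
      unfolding ways_of_meeting_def quotient_def by blast
    then show ?thesis using \<open>finite Q\<close> finite_subset by blast
  qed
  ultimately show ?thesis ..
qed

end
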